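(* Let $n\in\{2,3\}$ and $\varepsilon>0$, let $u^\varepsilon\in H^s(\Omega)$ ($s\ge 3$) be the solution of the regularized Monge-Ampère problem described in the context, and let $\ell=\min\{r+1,s\}$. Let $C_7(\varepsilon)$ and $h_0$ be the constants described in the context, and let $\rho_1=2C_7(\varepsilon)h^{\ell-2}\|u^\varepsilon\|_{H^\ell(\Omega)}$. Then there exists an $h_1>0$ such that for $h\le\min\{h_0,h_1\}$ there exists a unique solution $u^\varepsilon_h$, in the ball $B_h(\rho_1)$, of the Galerkin method: $u^\varepsilon_h\in V^h_g$ and $$-\varepsilon(\Delta u^\varepsilon_h,\Delta v_h)+(\det(D^2u^\varepsilon_h),v_h)=(f,v_h)-\Big\langle \varepsilon^2,\frac{\partial v_h}{\partial\nu}\Big\rangle_{\partial\Omega}\qquad\forall v_h\in V^h_0 .$$ Moreover, there exists a constant $C_8(\varepsilon)=O(\varepsilon^{-n})$ such that $$\|u^\varepsilon-u^\varepsilon_h\|_{H^2(\Omega)}\le C_8(\varepsilon)\,h^{\ell-2}\,\|u^\varepsilon\|_{H^\ell(\Omega)} .$$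
   Context: Continuous problem. $\Omega\subset\mathbf{R}^n$ ($n=2,3$) is a bounded convex domain with smooth or piecewise smooth boundary and unit outward normal $\nu$; $f>0$ in $\Omega$ and $g$ are given. For $\varepsilon>0$, $u^\varepsilon$ denotes the unique solution, which is convex, of $-\varepsilon\Delta^2u^\varepsilon+\det(D^2u^\varepsilon)=f$ in $\Omega$, $u^\varepsilon=g$ and $\Delta u^\varepsilon=\varepsilon$ on $\partial\Omega$. Weakly: $u^\varepsilon\in V_g$ and $-\varepsilon(\Delta u^\varepsilon,\Delta v)+(\det(D^2u^\varepsilon),v)=(f,v)-\langle\varepsilon^2,\partial v/\partial\nu\rangle_{\partial\Omega}$ for all $v\in V_0$. Here $V=H^2(\Omega)$, $V_0=H^2(\Omega)\cap H^1_0(\Omega)$, $V_g=\{v\in V: v|_{\partial\Omega}=g\}$, and $(\cdot,\cdot)$, $\langle\cdot,\cdot\rangle_{\partial\Omega}$ are the $L^2$ inner products on $\Omega$ and $\partial\Omega$. The following bounds (known from earlier work) are assumed: $\|u^\varepsilon\|_{H^j}=O(\varepsilon^{-(j-1)/2})$ for $j=2,3$, $\|u^\varepsilon\|_{W^{2,\infty}}=O(\varepsilon^{-1})$, $\|\mathrm{cof}(D^2u^\varepsilon)\|_{L^\infty}=O(\varepsilon^{-1})$. Set $\Phi^\varepsilon=\mathrm{cof}(D^2u^\varepsilon)$, the cofactor matrix of the Hessian, and $B[v,w]=\varepsilon\int_\Omega\Delta v\,\Delta w\,dx+\int_\Omega\Phi^\varepsilon Dv\cdot Dw\,dx$. Discrete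 spaces. $V^h\subset V$ is one of the following. (i) ($n=2$) A conforming finite element space of piecewise polynomials of degree $r\ge5$ (e.g. the Argyris element, $r=5$) on a quasiuniform triangular or rectangular partition of $\Omega$ of mesh size $h\in(0,1)$, with $\inf_{v_h\in V^h}\|v-v_h\|_{H^j}\le Ch^{\ell-j}\|v\|_{H^s}$ for $j=0,1,2$, $\ell=\min\{r+1,s\}$, $v\in V\cap H^s(\Omega)$. (ii) ($n=2,3$, $\Omega$ a rectangular domain) The Legendre spectral space $V^h=V^N$ spanned by tensor products of one-variable Legendre polynomials of degree at most $N$, $N\ge2$, with $h=1/N$ and $r:=N$; it satisfies $\inf_{v_N\in V^N}\|v-v_N\|_{H^j}\le CN^{j-s}\|v\|_{H^s}$ for $0\le j\le\min\{s,N+1\}$. $V^h_g=\{v_h\in V^h: v_h|_{\partial\Omega}=g\}$, $V^h_0=\{v_h\in V^h: v_h|_{\partial\Omega}=0\}$. $I_h$ denotes the usual interpolation operator onto $V^h$, preserving the boundary condition ($I_hu^\varepsilon\in V^h_g$) and having the optimal approximation property above. $C$ denotes a generic constant independent of $\varepsilon$. Fixed point map. $T:V^h_g\to V^h_g$ is defined by: for $w_h\in V^h_g$, $T(w_h)\in V^h_g$ is the unique solution of $B[w_h-T(w_h),\psi_h]=\varepsilon(\Delta w_h,\Delta\psi_h)-(\det(D^2w_h),\psi_h)+(f,\psi_h)-\langle\varepsilon^2,\partial\psi_h/\partial\nu\rangle_{\partial\Omega}$ for all $\psi_h\in V^h_0$. $B_h(\rho)=\{v_h\in V^h_g:\|v_h-I_hu^\varepsilon\|_{H^2}\le\rho\}$.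 Constants. $C_7(\varepsilon)=O(\varepsilon^{-n})$ is a positive constant such that $\|I_hu^\varepsilon-T(I_hu^\varepsilon)\|_{H^2}\le C_7(\varepsilon)h^{\ell-2}\|u^\varepsilon\|_{H^\ell}$. $h_0>0$, together with some $\rho_0\in(0,1)$, is such that for $h\le h_0$ one has $\|T(v_h)-T(w_h)\|_{H^2}\le\frac12\|v_h-w_h\|_{H^2}$ for all $v_h,w_h\in B_h(\rho_0)$. (Both are existence results established in the paper.) $O(\cdot)$ refers to $\varepsilon\to0$; the $\varepsilon$-dependent constants do not depend on $h$. *)

theory Defs
  imports "HOL-Analysis.Analysis" "HOL-Library.Landau_Symbols"
begin

section \<open>Classical derivatives and test functions\<close>

definition partial :: "'n::finite \<Rightarrow> (real^'n \<Rightarrow> real) \<Rightarrow> real^'n \<Rightarrow> real" where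
  "partial i \<phi> x = frechet_derivative \<phi> (at x) (axis i 1)"

primrec iter_partial :: "'n::finite list \<Rightarrow> (real^'n \<Rightarrow> real) \<Rightarrow> real^'n \<Rightarrow> real" where
  "iter_partial [] \<phi> = \<phi>"
| "iter_partial (i # ks) \<phi> = partial i (iter_partial ks \<phi>)"

text \<open>All iterated partial derivatives are differentiable everywhere; hence they are all
  continuous, and this is the class of infinitely differentiable functions.\<close>

definition smooth :: "(real^'n::finite \<Rightarrow> real) \<Rightarrow> bool" where
  "smooth \<phi> \<longleftrightarrow> (\<forall>ks x. iter_partial ks \<phi> differentiable (at x))"

definition test_function :: "(real^'n::finite) set \<Rightarrow> (real^'n \<Rightarrow> real) \<Rightarrow> bool" where
  "test_function \<Omega> \<phi> \<longleftrightarrow>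
     smooth \<phi> \<and> compact (closure {x. \<phi> x \<noteq> 0}) \<and> closure {x. \<phi> x \<noteq> 0} \<subseteq> \<Omega>"

text \<open>Multi-indices are functions from the (unordered) index type to \<^typ>\<open>nat\<close>.  The order in which
  the partial derivatives are taken is irrelevant for smooth functions, so it is chosen
  arbitrarily in \<open>multi_partial\<close>.\<close>

definition mi_order :: "('n::finite \<Rightarrow> nat) \<Rightarrow> nat" where
  "mi_order \<alpha> = (\<Sum>i\<in>UNIV. \<alpha> i)"

definition mi_unit :: "'n \<Rightarrow> 'n \<Rightarrow> nat" where
  "mi_unit i = (\<lambda>k. if k = i then 1 else 0)"

definition multi_partial :: "('n::finite \<Rightarrow> nat) \<Rightarrow> (real^'n \<Rightarrow> real) \<Rightarrow> real^'n \<Rightarrow> real" where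
  "multi_partial \<alpha> \<phi> = iter_partial (SOME ks. \<forall>i. count_list ks i = \<alpha> i) \<phi>"


section \<open>Weak derivatives and Sobolev spaces\<close>

definition L2_on :: "(real^'n::finite) set \<Rightarrow> (real^'n \<Rightarrow> real) \<Rightarrow> bool" where
  "L2_on \<Omega> w \<longleftrightarrow>
     w \<in> borel_measurable (lebesgue_on \<Omega>) \<and> integrable (lebesgue_on \<Omega>) (\<lambda>x. (w x)\<^sup>2)"

definition inner_L2 ::
    "(real^'n::finite) set \<Rightarrow> (real^'n \<Rightarrow> real) \<Rightarrow> (real^'n \<Rightarrow> real) \<Rightarrow> real" where
  "inner_L2 \<Omega> v w = (\<integral>x. v x * w x \<partial>lebesgue_on \<Omega>)"

definition locally_integrable :: "(real^'n::finite) set \<Rightarrow> (real^'n \<Rightarrow> real) \<Rightarrow> bool" where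
  "locally_integrable \<Omega> w \<longleftrightarrow> (\<forall>K. compact K \<and> K \<subseteq> \<Omega> \<longrightarrow> integrable (lebesgue_on K) w)"

definition is_weak_deriv ::
    "(real^'n::finite) set \<Rightarrow> ('n \<Rightarrow> nat) \<Rightarrow> (real^'n \<Rightarrow> real) \<Rightarrow> (real^'n \<Rightarrow> real) \<Rightarrow> bool" where
  "is_weak_deriv \<Omega> \<alpha> v w \<longleftrightarrow>
     locally_integrable \<Omega> v \<and> locally_integrable \<Omega> w \<and>
     (\<forall>\<phi>. test_function \<Omega> \<phi> \<longrightarrow>
        inner_L2 \<Omega> v (multi_partial \<alpha> \<phi>) = (-1) ^ mi_order \<alpha> * inner_L2 \<Omega> w \<phi>)"

text \<open>Weak derivatives are unique almost everywhere, and everything below depends on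
  \<open>wderiv\<close> only through integrals and almost-everywhere statements.\<close>

definition wderiv ::
    "(real^'n::finite) set \<Rightarrow> ('n \<Rightarrow> nat) \<Rightarrow> (real^'n \<Rightarrow> real) \<Rightarrow> real^'n \<Rightarrow> real" where
  "wderiv \<Omega> \<alpha> v = (SOME w. is_weak_deriv \<Omega> \<alpha> v w)"

text \<open>\<open>Hsp \<Omega> s\<close> is the space \<open>H^s(\<Omega>)\<close> for real \<open>s \<ge> 0\<close>.  For non-integral \<open>s = m + \<sigma>\<close> with
  \<open>0 < \<sigma> < 1\<close> it is the Sobolev--Slobodeckij space, with the Gagliardo seminorm
  of the derivatives of order \<open>m\<close>.\<close>

definition gagliardo_integrand ::
    "(real^'n::finite) set \<Rightarrow> real \<Rightarrow> ('n \<Rightarrow> nat) \<Rightarrow> (real^'n \<Rightarrow> real) \<Rightarrow> (real^'n) \<times> (real^'n) \<Rightarrow> real"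
  where
  "gagliardo_integrand \<Omega> \<sigma> \<alpha> v = (\<lambda>(x, y).
     (wderiv \<Omega> \<alpha> v x - wderiv \<Omega> \<alpha> v y)\<^sup>2 / (norm (x - y) powr (real CARD('n) + 2 * \<sigma>)))"

definition Hsp :: "(real^'n::finite) set \<Rightarrow> real \<Rightarrow> (real^'n \<Rightarrow> real) set" where
  "Hsp \<Omega> s = {v.
     (\<forall>\<alpha>. mi_order \<alpha> \<le> nat \<lfloor>s\<rfloor> \<longrightarrow> (\<exists>w. is_weak_deriv \<Omega> \<alpha> v w \<and> L2_on \<Omega> w)) \<and>
     (frac s > 0 \<longrightarrow> (\<forall>\<alpha>. mi_order \<alpha> = nat \<lfloor>s\<rfloor> \<longrightarrow>
        integrable (lebesgue_on \<Omega> \<Otimes>\<^sub>M lebesgue_on \<Omega>) (gagliardo_integrand \<Omega> (frac s) \<alpha> v)))}"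

definition Hnorm :: "(real^'n::finite) set \<Rightarrow> real \<Rightarrow> (real^'n \<Rightarrow> real) \<Rightarrow> real" where
  "Hnorm \<Omega> s v = sqrt (
     (\<Sum>\<alpha> | mi_order \<alpha> \<le> nat \<lfloor>s\<rfloor>. \<integral>x. (wderiv \<Omega> \<alpha> v x)\<^sup>2 \<partial>lebesgue_on \<Omega>) +
     (if frac s > 0
      then \<Sum>\<alpha> | mi_order \<alpha> = nat \<lfloor>s\<rfloor>.
             integral\<^sup>L (lebesgue_on \<Omega> \<Otimes>\<^sub>M lebesgue_on \<Omega>) (gagliardo_integrand \<Omega> (frac s) \<alpha> v)
      else 0))"

definition ess_bounded :: "(real^'n::finite) set \<Rightarrow> (real^'n \<Rightarrow> real) \<Rightarrow> bool" where
  "ess_bounded \<Omega> w \<longleftrightarrow> w \<in> borel_measurable (lebesgue_on \<Omega>) \<and>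
     (\<exists>M. AE x in lebesgue_on \<Omega>. \<bar>w x\<bar> \<le> M)"

definition Linf_norm :: "(real^'n::finite) set \<Rightarrow> (real^'n \<Rightarrow> 'b::real_normed_vector) \<Rightarrow> real" where
  "Linf_norm \<Omega> w = Inf {M. 0 \<le> M \<and> (AE x in lebesgue_on \<Omega>. norm (w x) \<le> M)}"

definition W2inf :: "(real^'n::finite) set \<Rightarrow> (real^'n \<Rightarrow> real) set" where
  "W2inf \<Omega> = {v. \<forall>\<alpha>. mi_order \<alpha> \<le> 2 \<longrightarrow> (\<exists>w. is_weak_deriv \<Omega> \<alpha> v w \<and> ess_bounded \<Omega> w)}"

definition W2inf_norm :: "(real^'n::finite) set \<Rightarrow> (real^'n \<Rightarrow> real) \<Rightarrow> real" where
  "W2inf_norm \<Omega> v = Max ((\<lambda>\<alpha>. Linf_norm \<Omega> (wderiv \<Omega> \<alpha> v)) ` {\<alpha>. mi_order \<alpha> \<le> 2})"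

definition grad :: "(real^'n::finite) set \<Rightarrow> (real^'n \<Rightarrow> real) \<Rightarrow> real^'n \<Rightarrow> real^'n" where
  "grad \<Omega> v x = (\<chi> i. wderiv \<Omega> (mi_unit i) v x)"

definition hessian :: "(real^'n::finite) set \<Rightarrow> (real^'n \<Rightarrow> real) \<Rightarrow> real^'n \<Rightarrow> real^'n^'n" where
  "hessian \<Omega> v x = (\<chi> i j. wderiv \<Omega> (\<lambda>k. mi_unit i k + mi_unit j k) v x)"

definition laplacian :: "(real^'n::finite) set \<Rightarrow> (real^'n \<Rightarrow> real) \<Rightarrow> real^'n \<Rightarrow> real" where
  "laplacian \<Omega> v x = (\<Sum>i\<in>UNIV. hessian \<Omega> v x $ i $ i)"

text \<open>The \<open>(i,j)\<close> cofactor, sign included, is the determinant of the matrix with row \<open>i\<close> and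
  column \<open>j\<close> replaced by unit vectors.\<close>

definition cof :: "real^'n^'n \<Rightarrow> real^'n^'n::finite" where
  "cof A = (\<chi> i j. det (\<chi> k l. if k = i \<and> l = j then 1
                              else if k = i \<or> l = j then 0 else A $ k $ l))"

definition H10 :: "(real^'n::finite) set \<Rightarrow> (real^'n \<Rightarrow> real) set" where
  "H10 \<Omega> = {v \<in> Hsp \<Omega> 1. \<exists>\<phi>. (\<forall>k::nat. test_function \<Omega> (\<phi> k)) \<and>
     (\<lambda>k. Hnorm \<Omega> 1 (\<lambda>x. v x - \<phi> k x)) \<longlonglongrightarrow> 0}"


section \<open>The boundary: surface measure, normal, traces\<close>

text \<open>\<open>d\<close>-dimensional Hausdorff measure, normalised so that it agrees with surface measure.
  The Hausdorff outer measure is countably additive on Borel sets, so the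
  degenerate case of \<^const>\<open>measure_of\<close> does not arise.\<close>

definition hausdorff_outer :: "nat \<Rightarrow> (real^'n::finite) set \<Rightarrow> ennreal" where
  "hausdorff_outer d A = (SUP \<delta>\<in>{0<..}.
     INF U\<in>{U :: nat \<Rightarrow> (real^'n) set.
              A \<subseteq> (\<Union>i. U i) \<and> (\<forall>i. bounded (U i) \<and> diameter (U i) \<le> \<delta>)}.
       (\<Sum>i. ennreal (unit_ball_vol (real d) * (diameter (U i) / 2) ^ d)))"

definition surface_measure :: "(real^'n::finite) set \<Rightarrow> (real^'n) measure" where
  "surface_measure \<Omega> =
     restrict_space (measure_of UNIV (sets borel) (hausdorff_outer (CARD('n) - 1))) (frontier \<Omega>)"

text \<open>For a convex domain the outward unit normal at a boundary point is the unit normal of the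
  supporting hyperplane.  It is unique outside corners and edges, which are null sets; there the
  value is set to 0.\<close>

definition outer_normal :: "(real^'n::finite) set \<Rightarrow> real^'n \<Rightarrow> real^'n" where
  "outer_normal \<Omega> x =
     (if \<exists>!\<nu>. norm \<nu> = 1 \<and> (\<forall>y\<in>\<Omega>. \<nu> \<bullet> (y - x) \<le> 0)
      then THE \<nu>. norm \<nu> = 1 \<and> (\<forall>y\<in>\<Omega>. \<nu> \<bullet> (y - x) \<le> 0) else 0)"

text \<open>Boundary trace of an \<open>H^1\<close> function: the limit in \<open>L^2(\<partial>\<Omega>)\<close> of the boundary values of
  smooth functions converging in \<open>H^1(\<Omega>)\<close>.\<close>

definition has_trace ::
    "(real^'n::finite) set \<Rightarrow> (real^'n \<Rightarrow> real) \<Rightarrow> (real^'n \<Rightarrow> real) \<Rightarrow> bool" where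
  "has_trace \<Omega> w \<tau> \<longleftrightarrow>
     w \<in> Hsp \<Omega> 1 \<and> \<tau> \<in> borel_measurable (surface_measure \<Omega>) \<and>
     integrable (surface_measure \<Omega>) (\<lambda>x. (\<tau> x)\<^sup>2) \<and>
     (\<exists>\<phi>. (\<forall>k::nat. smooth (\<phi> k)) \<and>
        (\<lambda>k. Hnorm \<Omega> 1 (\<lambda>x. w x - \<phi> k x)) \<longlonglongrightarrow> 0 \<and>
        (\<lambda>k. \<integral>x. (\<tau> x - \<phi> k x)\<^sup>2 \<partial>surface_measure \<Omega>) \<longlonglongrightarrow> 0)"

definition trace :: "(real^'n::finite) set \<Rightarrow> (real^'n \<Rightarrow> real) \<Rightarrow> real^'n \<Rightarrow> real" where
  "trace \<Omega> w = (SOME \<tau>. has_trace \<Omega> w \<tau>)"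

definition normal_deriv :: "(real^'n::finite) set \<Rightarrow> (real^'n \<Rightarrow> real) \<Rightarrow> real^'n \<Rightarrow> real" where
  "normal_deriv \<Omega> v x =
     (\<Sum>i\<in>UNIV. trace \<Omega> (wderiv \<Omega> (mi_unit i) v) x * outer_normal \<Omega> x $ i)"

definition boundary_inner ::
    "(real^'n::finite) set \<Rightarrow> (real^'n \<Rightarrow> real) \<Rightarrow> (real^'n \<Rightarrow> real) \<Rightarrow> real" where
  "boundary_inner \<Omega> v w = (\<integral>x. v x * w x \<partial>surface_measure \<Omega>)"

text \<open>The boundary is, up to the relative boundaries of the pieces, a disjoint union of finitely many
  relatively open pieces whose closures lie in regular smooth hypersurfaces.  A smooth boundary
  is the case of a single piece.\<close>

definition piecewise_smooth_boundary :: "(real^'n::finite) set \<Rightarrow> bool" where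
  "piecewise_smooth_boundary \<Omega> \<longleftrightarrow>
     (\<exists>\<G>. finite \<G> \<and> disjoint \<G> \<and>
        (\<forall>G\<in>\<G>. openin (top_of_set (frontier \<Omega>)) G \<and>
           (\<exists>\<phi>. smooth \<phi> \<and> (\<forall>x\<in>closure G. \<phi> x = 0 \<and> (\<exists>i. partial i \<phi> x \<noteq> 0)))) \<and>
        frontier \<Omega> = \<Union> (closure ` \<G>))"

definition convex_domain :: "(real^'n::finite) set \<Rightarrow> bool" where
  "convex_domain \<Omega> \<longleftrightarrow>
     open \<Omega> \<and> \<Omega> \<noteq> {} \<and> bounded \<Omega> \<and> convex \<Omega> \<and> piecewise_smooth_boundary \<Omega>"


section \<open>The regularized Monge--Ampere problem\<close>

definition V_bc :: "(real^'n::finite) set \<Rightarrow> (real^'n \<Rightarrow> real) \<Rightarrow> (real^'n \<Rightarrow> real) set" where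
  "V_bc \<Omega> g = {v \<in> Hsp \<Omega> 2. has_trace \<Omega> v g}"

definition V_zero :: "(real^'n::finite) set \<Rightarrow> (real^'n \<Rightarrow> real) set" where
  "V_zero \<Omega> = Hsp \<Omega> 2 \<inter> H10 \<Omega>"

text \<open>The weak identity tested with a single \<open>v\<close>, for the continuous and the discrete problem alike.\<close>

definition MA_identity ::
    "(real^'n::finite) set \<Rightarrow> (real^'n \<Rightarrow> real) \<Rightarrow> real \<Rightarrow> (real^'n \<Rightarrow> real) \<Rightarrow> (real^'n \<Rightarrow> real) \<Rightarrow> bool"
  where
  "MA_identity \<Omega> f \<epsilon> w v \<longleftrightarrow>
     - \<epsilon> * inner_L2 \<Omega> (laplacian \<Omega> w) (laplacian \<Omega> v)
       + inner_L2 \<Omega> (\<lambda>x. det (hessian \<Omega> w x)) v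
     = inner_L2 \<Omega> f v - boundary_inner \<Omega> (\<lambda>x. \<epsilon>\<^sup>2) (normal_deriv \<Omega> v)"

definition convex_weak_solution ::
    "(real^'n::finite) set \<Rightarrow> (real^'n \<Rightarrow> real) \<Rightarrow> (real^'n \<Rightarrow> real) \<Rightarrow> real \<Rightarrow> (real^'n \<Rightarrow> real) \<Rightarrow> bool"
  where
  "convex_weak_solution \<Omega> f g \<epsilon> w \<longleftrightarrow>
     w \<in> V_bc \<Omega> g \<and>
     (\<forall>v \<in> V_zero \<Omega>. integrable (lebesgue_on \<Omega>) (\<lambda>x. det (hessian \<Omega> w x) * v x) \<and>
        MA_identity \<Omega> f \<epsilon> w v) \<and>
     (\<exists>w'. convex_on \<Omega> w' \<and> (AE x in lebesgue_on \<Omega>. w x = w' x))"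

definition the_convex_solution ::
    "(real^'n::finite) set \<Rightarrow> (real^'n \<Rightarrow> real) \<Rightarrow> (real^'n \<Rightarrow> real) \<Rightarrow> real \<Rightarrow> (real^'n \<Rightarrow> real) \<Rightarrow> bool"
  where
  "the_convex_solution \<Omega> f g \<epsilon> u \<longleftrightarrow>
     convex_weak_solution \<Omega> f g \<epsilon> u \<and>
     (\<forall>w. convex_weak_solution \<Omega> f g \<epsilon> w \<longrightarrow> (AE x in lebesgue_on \<Omega>. w x = u x))"

definition a_priori_bounds :: "(real^'n::finite) set \<Rightarrow> (real \<Rightarrow> real^'n \<Rightarrow> real) \<Rightarrow> bool" where
  "a_priori_bounds \<Omega> u \<longleftrightarrow>
     (\<forall>\<epsilon>>0. u \<epsilon> \<in> W2inf \<Omega>) \<and>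
     (\<forall>j\<in>{2, 3}. (\<lambda>\<epsilon>. Hnorm \<Omega> j (u \<epsilon>)) \<in> O[at_right 0](\<lambda>\<epsilon>. \<epsilon> powr (- (j - 1) / 2))) \<and>
     (\<lambda>\<epsilon>. W2inf_norm \<Omega> (u \<epsilon>)) \<in> O[at_right 0](\<lambda>\<epsilon>. 1 / \<epsilon>) \<and>
     (\<lambda>\<epsilon>. Linf_norm \<Omega> (\<lambda>x. cof (hessian \<Omega> (u \<epsilon>) x))) \<in> O[at_right 0](\<lambda>\<epsilon>. 1 / \<epsilon>)"

definition lin_form ::
    "(real^'n::finite) set \<Rightarrow> real \<Rightarrow> (real^'n \<Rightarrow> real) \<Rightarrow> (real^'n \<Rightarrow> real) \<Rightarrow> (real^'n \<Rightarrow> real) \<Rightarrow> real"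
  where
  "lin_form \<Omega> \<epsilon> u v w =
     \<epsilon> * (\<integral>x. laplacian \<Omega> v x * laplacian \<Omega> w x \<partial>lebesgue_on \<Omega>)
     + (\<integral>x. (cof (hessian \<Omega> u x) *v grad \<Omega> v x) \<bullet> grad \<Omega> w x \<partial>lebesgue_on \<Omega>)"


section \<open>Discrete spaces\<close>

text \<open>Elements of a discrete space are genuine functions: the continuous representative on
  \<^term>\<open>closure \<Omega>\<close>, extended by 0.  So boundary values are pointwise values, and equality of
  discrete functions is equality on \<^term>\<open>closure \<Omega>\<close>.\<close>

definition triangle_cell :: "(real^'n::finite) set \<Rightarrow> (real^'n) set \<Rightarrow> bool" where
  "triangle_cell \<Omega> K \<longleftrightarrow>
     (\<exists>p q t. \<not> collinear {p, q, t} \<and> K = convex hull {p, q, t} \<inter> closure \<Omega>)"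

definition rectangle :: "real^'n::finite \<Rightarrow> real^'n \<Rightarrow> real^'n \<Rightarrow> (real^'n) set" where
  "rectangle p a b = {p + s *\<^sub>R a + t *\<^sub>R b | s t. s \<in> {0..1} \<and> t \<in> {0..1}}"

definition rectangle_cell :: "(real^'n::finite) set \<Rightarrow> (real^'n) set \<Rightarrow> bool" where
  "rectangle_cell \<Omega> K \<longleftrightarrow>
     (\<exists>p a b. a \<noteq> 0 \<and> b \<noteq> 0 \<and> a \<bullet> b = 0 \<and> K = rectangle p a b \<inter> closure \<Omega>)"

text \<open>Polynomials of total degree at most \<open>r\<close> on triangles, and of degree at most \<open>r\<close> in
  each of the two side directions on rectangles.\<close>

definition poly_on_triangle :: "nat \<Rightarrow> (real^'n::finite) set \<Rightarrow> (real^'n \<Rightarrow> real) \<Rightarrow> bool" where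
  "poly_on_triangle r K v \<longleftrightarrow>
     (\<exists>c. \<forall>x\<in>K. v x = (\<Sum>\<alpha> | mi_order \<alpha> \<le> r. c \<alpha> * (\<Prod>i\<in>UNIV. (x $ i) ^ \<alpha> i)))"

definition poly_on_rectangle ::
    "(real^'n::finite) set \<Rightarrow> nat \<Rightarrow> (real^'n) set \<Rightarrow> (real^'n \<Rightarrow> real) \<Rightarrow> bool" where
  "poly_on_rectangle \<Omega> r K v \<longleftrightarrow>
     (\<exists>p a b c. a \<noteq> 0 \<and> b \<noteq> 0 \<and> a \<bullet> b = 0 \<and> K = rectangle p a b \<inter> closure \<Omega> \<and>
        (\<forall>s t. p + s *\<^sub>R a + t *\<^sub>R b \<in> K \<longrightarrow>
           v (p + s *\<^sub>R a + t *\<^sub>R b) = (\<Sum>i\<le>r. \<Sum>j\<le>r. c i j * s ^ i * t ^ j)))"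

text \<open>Cells are intersections of triangles or rectangles with \<^term>\<open>closure \<Omega>\<close>, which allows
  curved sides along a curved boundary; they meet face to face.\<close>

definition partition_of ::
    "(real^'n::finite) set \<Rightarrow> ((real^'n) set \<Rightarrow> bool) \<Rightarrow> (real^'n) set set \<Rightarrow> bool" where
  "partition_of \<Omega> cell \<T> \<longleftrightarrow>
     finite \<T> \<and> (\<forall>K\<in>\<T>. cell K \<and> interior K \<noteq> {}) \<and> \<Union>\<T> = closure \<Omega> \<and>
     (\<forall>K\<in>\<T>. \<forall>L\<in>\<T>. K \<noteq> L \<longrightarrow>
        interior K \<inter> interior L = {} \<and> (K \<inter> L) face_of K \<and> (K \<inter> L) face_of L)"

definition quasiuniform :: "real set \<Rightarrow> (real \<Rightarrow> (real^'n::finite) set set) \<Rightarrow> bool" where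
  "quasiuniform H \<T> \<longleftrightarrow>
     (\<forall>h\<in>H. h = Max (diameter ` \<T> h)) \<and>
     (\<exists>\<kappa>>0. \<forall>h\<in>H. \<forall>K\<in>\<T> h. \<exists>x. ball x (\<kappa> * h) \<subseteq> K)"

definition fin_dim_space :: "('a \<Rightarrow> real) set \<Rightarrow> bool" where
  "fin_dim_space V \<longleftrightarrow> (\<exists>B. finite B \<and> V = {\<lambda>x. \<Sum>b\<in>B. c b * b x | c. True})"

text \<open>\<open>H\<close> is the set of discretisation parameters \<open>h\<close>, and \<open>r h\<close> the polynomial degree of \<open>Vh h\<close>.\<close>

definition fem_spaces ::
    "(real^'n::finite) set \<Rightarrow> real set \<Rightarrow> (real \<Rightarrow> nat) \<Rightarrow> (real \<Rightarrow> (real^'n \<Rightarrow> real) set) \<Rightarrow> bool"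
  where
  "fem_spaces \<Omega> H r Vh \<longleftrightarrow>
     CARD('n) = 2 \<and> H \<subseteq> {0<..<1} \<and>
     (\<exists>k\<ge>5. (\<forall>h\<in>H. r h = k)) \<and>
     (\<exists>\<T>. quasiuniform H \<T> \<and>
        ((\<forall>h\<in>H. partition_of \<Omega> (triangle_cell \<Omega>) (\<T> h) \<and>
            (\<forall>v\<in>Vh h. \<forall>K\<in>\<T> h. poly_on_triangle (r h) K v)) \<or>
         (\<forall>h\<in>H. partition_of \<Omega> (rectangle_cell \<Omega>) (\<T> h) \<and>
            (\<forall>v\<in>Vh h. \<forall>K\<in>\<T> h. poly_on_rectangle \<Omega> (r h) K v)))) \<and>
     (\<forall>h\<in>H. fin_dim_space (Vh h) \<and> Vh h \<subseteq> Hsp \<Omega> 2 \<and>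
        (\<forall>v\<in>Vh h. \<forall>x. x \<notin> closure \<Omega> \<longrightarrow> v x = 0)) \<and>
     (\<forall>s\<ge>2. \<exists>C>0. \<forall>h\<in>H. \<forall>j\<in>{0, 1, 2::nat}. \<forall>v \<in> Hsp \<Omega> 2 \<inter> Hsp \<Omega> s.
        (INF w\<in>Vh h. Hnorm \<Omega> (real j) (\<lambda>x. v x - w x))
          \<le> C * h powr (min (real (r h) + 1) s - real j) * Hnorm \<Omega> s v)"

fun legendre :: "nat \<Rightarrow> real \<Rightarrow> real" where
  "legendre 0 x = 1"
| "legendre (Suc 0) x = x"
| "legendre (Suc (Suc k)) x =
     ((2 * real k + 3) * x * legendre (Suc k) x - (real k + 1) * legendre k x) / (real k + 2)"

text \<open>Legendre polynomials are transported affinely from \<open>[-1, 1]\<close> to the sides of the box.\<close>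

definition legendre_space ::
    "real^'n::finite \<Rightarrow> real^'n \<Rightarrow> nat \<Rightarrow> (real^'n \<Rightarrow> real) set" where
  "legendre_space a b N =
     {\<lambda>x. if x \<in> cbox a b
          then \<Sum>\<alpha> | \<forall>i. \<alpha> i \<le> N.
                 c \<alpha> * (\<Prod>i\<in>UNIV. legendre (\<alpha> i) ((2 * x $ i - a $ i - b $ i) / (b $ i - a $ i)))
          else 0
      | c. True}"

definition spectral_spaces ::
    "(real^'n::finite) set \<Rightarrow> real set \<Rightarrow> (real \<Rightarrow> nat) \<Rightarrow> (real \<Rightarrow> (real^'n \<Rightarrow> real) set) \<Rightarrow> bool"
  where
  "spectral_spaces \<Omega> H r Vh \<longleftrightarrow>
     (\<exists>a b. (\<forall>i. a $ i < b $ i) \<and> \<Omega> = box a b \<and>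
        H = {1 / real N | N. N \<ge> 2} \<and>
        (\<forall>N\<ge>2. r (1 / real N) = N \<and> Vh (1 / real N) = legendre_space a b N)) \<and>
     (\<forall>h\<in>H. Vh h \<subseteq> Hsp \<Omega> 2) \<and>
     (\<forall>s\<ge>0. \<exists>C>0. \<forall>N\<ge>2. \<forall>j. real j \<le> min s (real N + 1) \<longrightarrow>
        (\<forall>v \<in> Hsp \<Omega> 2 \<inter> Hsp \<Omega> s.
           (INF w\<in>Vh (1 / real N). Hnorm \<Omega> (real j) (\<lambda>x. v x - w x))
             \<le> C * real N powr (real j - s) * Hnorm \<Omega> s v))"

definition Vh_bc ::
    "(real^'n::finite) set \<Rightarrow> (real^'n \<Rightarrow> real) set \<Rightarrow> (real^'n \<Rightarrow> real) \<Rightarrow> (real^'n \<Rightarrow> real) set" where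
  "Vh_bc \<Omega> V g = {v \<in> V. \<forall>x\<in>frontier \<Omega>. v x = g x}"

abbreviation Vh_zero ::
    "(real^'n::finite) set \<Rightarrow> (real^'n \<Rightarrow> real) set \<Rightarrow> (real^'n \<Rightarrow> real) set" where
  "Vh_zero \<Omega> V \<equiv> Vh_bc \<Omega> V (\<lambda>x. 0)"

definition ell :: "(real \<Rightarrow> nat) \<Rightarrow> real \<Rightarrow> real \<Rightarrow> real" where
  "ell r s h = min (real (r h) + 1) s"

text \<open>The interpolation operator enters only through the properties of a linear projection onto
  the discrete space with the optimal approximation property at regularity \<open>\<ell> = ell r s h\<close>.
  Higher or lower regularities are not required, so that nodal interpolation is
  admitted whenever it is defined on \<open>H^\<ell>\<close>.\<close>

definition interpolation_operator ::
    "(real^'n::finite) set \<Rightarrow> real set \<Rightarrow> (real \<Rightarrow> nat) \<Rightarrow> (real \<Rightarrow> (real^'n \<Rightarrow> real) set) \<Rightarrow> real \<Rightarrow>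
     (real \<Rightarrow> (real^'n \<Rightarrow> real) \<Rightarrow> (real^'n \<Rightarrow> real)) \<Rightarrow> bool" where
  "interpolation_operator \<Omega> H r Vh s Ih \<longleftrightarrow>
     (\<forall>h\<in>H. \<forall>v \<in> Hsp \<Omega> (ell r s h). Ih h v \<in> Vh h) \<and>
     (\<forall>h\<in>H. \<forall>v \<in> Vh h. Ih h v = v) \<and>
     (\<forall>h\<in>H. \<forall>v \<in> Hsp \<Omega> (ell r s h). \<forall>w \<in> Hsp \<Omega> (ell r s h). \<forall>a b.
        Ih h (\<lambda>x. a * v x + b * w x) = (\<lambda>x. a * Ih h v x + b * Ih h w x)) \<and>
     (\<exists>C>0. \<forall>h\<in>H. \<forall>j\<in>{0, 1, 2::nat}. \<forall>v \<in> Hsp \<Omega> (ell r s h).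
        Hnorm \<Omega> (real j) (\<lambda>x. v x - Ih h v x)
          \<le> C * h powr (ell r s h - real j) * Hnorm \<Omega> (ell r s h) v)"


section \<open>Fixed point map, ball, Galerkin method\<close>

definition T_equation ::
    "(real^'n::finite) set \<Rightarrow> (real^'n \<Rightarrow> real) set \<Rightarrow> (real^'n \<Rightarrow> real) \<Rightarrow> (real^'n \<Rightarrow> real) \<Rightarrow> real \<Rightarrow>
     (real^'n \<Rightarrow> real) \<Rightarrow> (real^'n \<Rightarrow> real) \<Rightarrow> (real^'n \<Rightarrow> real) \<Rightarrow> bool" where
  "T_equation \<Omega> V f g \<epsilon> u w z \<longleftrightarrow>
     z \<in> Vh_bc \<Omega> V g \<and>
     (\<forall>\<psi> \<in> Vh_zero \<Omega> V.
        lin_form \<Omega> \<epsilon> u (\<lambda>x. w x - z x) \<psi> =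
          \<epsilon> * inner_L2 \<Omega> (laplacian \<Omega> w) (laplacian \<Omega> \<psi>)
          - inner_L2 \<Omega> (\<lambda>x. det (hessian \<Omega> w x)) \<psi>
          + inner_L2 \<Omega> f \<psi>
          - boundary_inner \<Omega> (\<lambda>x. \<epsilon>\<^sup>2) (normal_deriv \<Omega> \<psi>))"

definition T_map ::
    "(real^'n::finite) set \<Rightarrow> (real^'n \<Rightarrow> real) set \<Rightarrow> (real^'n \<Rightarrow> real) \<Rightarrow> (real^'n \<Rightarrow> real) \<Rightarrow> real \<Rightarrow>
     (real^'n \<Rightarrow> real) \<Rightarrow> (real^'n \<Rightarrow> real) \<Rightarrow> (real^'n \<Rightarrow> real)" where
  "T_map \<Omega> V f g \<epsilon> u w = (THE z. T_equation \<Omega> V f g \<epsilon> u w z)"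

text \<open>\<open>c\<close> is the centre of the ball.\<close>

definition Bh ::
    "(real^'n::finite) set \<Rightarrow> (real^'n \<Rightarrow> real) set \<Rightarrow> (real^'n \<Rightarrow> real) \<Rightarrow> (real^'n \<Rightarrow> real) \<Rightarrow> real \<Rightarrow>
     (real^'n \<Rightarrow> real) set" where
  "Bh \<Omega> V g c \<rho> = {v \<in> Vh_bc \<Omega> V g. Hnorm \<Omega> 2 (\<lambda>x. v x - c x) \<le> \<rho>}"

definition galerkin_solution ::
    "(real^'n::finite) set \<Rightarrow> (real^'n \<Rightarrow> real) set \<Rightarrow> (real^'n \<Rightarrow> real) \<Rightarrow> (real^'n \<Rightarrow> real) \<Rightarrow> real \<Rightarrow>
     (real^'n \<Rightarrow> real) \<Rightarrow> bool" where
  "galerkin_solution \<Omega> V f g \<epsilon> w \<longleftrightarrow>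
     w \<in> Vh_bc \<Omega> V g \<and> (\<forall>v \<in> Vh_zero \<Omega> V. MA_identity \<Omega> f \<epsilon> w v)"

end

theory Submission
  imports Defs "HOL-Computational_Algebra.Polynomial"
begin

text \<open>The solution of the Galerkin equation is a fixed point of the map \<open>T\<close>: the defining equation of
  \<open>T w\<close> with \<open>T w = w\<close> has the left-hand side \<open>B[0, \<psi>] = 0\<close>, and what remains is the Galerkin
  equation for \<open>w\<close>.  On the ball of radius \<open>\<rho>1\<close> about the interpolant, \<open>T\<close> halves distances as soon as \<open>h \<le> h0\<close> and
  \<open>\<rho>1 \<le> \<rho>0\<close>, and it moves the centre by at most \<open>\<rho>1 / 2\<close>, so it maps the ball into itself.  The
  contraction principle gives the fixed point and its uniqueness.  The exponent \<open>\<ell> - 2\<close> is at least 1 and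
  \<open>\<ell>\<close> does not depend on \<open>h\<close> once \<open>h\<close> is small, so \<open>\<rho>1\<close> is at most a constant times \<open>h\<close>, and \<open>\<rho>1 \<le> \<rho>0\<close> holds
  for small \<open>h\<close>.  The error bound is the interpolation error plus the radius \<open>\<rho>1\<close>.

  The analytic content is that the \<open>H^2\<close> norm really is a seminorm, and that a function of norm zero
  contributes nothing to the form \<open>B\<close>.  Since \<open>wderiv\<close> is an arbitrary choice among the weak derivatives,
  both facts rest on the almost-everywhere uniqueness of weak derivatives, that is, on the fundamental
  lemma of the calculus of variations (\<open>fundamental_lemma_of_variations\<close>).  Smooth bump functions
  that increase to the indicator of a box (\<open>box_bump\<close>) show that the function in question has integral
  zero over every box, and Lebesgue differentiation concludes.

  The contraction principle is used in the following form.  A finite-dimensional space of functions is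
  complete for every seminorm (\<open>finite_dimensional_complete\<close>), so the Picard iteration has a
  limit \<open>z\<close> in the discrete space with the right boundary values, and \<open>z\<close> is at distance zero from
  \<open>T z\<close> (\<open>contraction_approximate_fixed_point\<close>).  Distance zero does not distinguish functions that agree almost
  everywhere; but \<open>B[z - T z, \<psi>] = B[z - z, \<psi>] = 0\<close>, so both \<open>z\<close> and \<open>T z\<close> solve the equation defining
  \<open>T z\<close>, whose solution is unique.  Hence \<open>T z = z\<close> as functions.  The same argument gives
  uniqueness.\<close>

section \<open>Smooth bump functions on boxes\<close>

text \<open>The functions \<open>P / q^m * exp (-1/q)\<close> for a fixed polynomial \<open>q\<close>, cut off where \<open>q \<le> 0\<close>, form a family
  closed under differentiation.  Smoothness of the whole family is thus a single
  differentiability statement.\<close>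
definition flat_fun :: "real poly \<Rightarrow> real poly \<Rightarrow> nat \<Rightarrow> real \<Rightarrow> real" where
  "flat_fun q P m t = (if poly q t > 0 then poly P t / poly q t ^ m * exp (- 1 / poly q t) else 0)"

lemma exp_minus_inverse_le_power:
  fixes y :: real
  assumes "y > 0"
  shows "exp (- 1 / y) \<le> real (Suc N) ^ Suc N * y ^ Suc N"
proof -
  have "1 / (real (Suc N) * y) \<le> exp (1 / (real (Suc N) * y))"
    using exp_ge_add_one_self[of "1 / (real (Suc N) * y)"] by linarith
  then have "(1 / (real (Suc N) * y)) ^ Suc N \<le> exp (1 / (real (Suc N) * y)) ^ Suc N"
    using assms by (intro power_mono) auto
  also have "\<dots> = exp (1 / y)"
    using exp_of_nat_mult[of "Suc N" "1 / (real (Suc N) * y)"] assms by simp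
  finally have "1 / (real (Suc N) * y) ^ Suc N \<le> exp (1 / y)"
    by (simp only: power_one_over)
  then have "1 \<le> exp (1 / y) * (real (Suc N) * y) ^ Suc N"
    using assms by (simp only: divide_le_eq) (simp add: zero_less_mult_iff)
  then have "exp (- (1 / y)) \<le> exp (- (1 / y)) * (exp (1 / y) * (real (Suc N) * y) ^ Suc N)"
    by (metis exp_ge_zero mult.right_neutral mult_left_mono)
  also have "\<dots> = (real (Suc N) * y) ^ Suc N"
    by (simp add: exp_minus)
  finally show ?thesis by (simp only: power_mult_distrib) simp
qed

text \<open>Away from the zeros of \<open>q\<close> this is the quotient rule.  At a zero of \<open>q\<close> the exponential beats
  the denominator: the function is \<open>O(q^2)\<close>, while \<open>q\<close> vanishes at least to first order, so the difference quotient
  tends to 0.\<close>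
lemma flat_fun_deriv:
  "(flat_fun q P m has_real_derivative
      flat_fun q (pderiv P * q ^ 2 - of_nat m * P * pderiv q * q + P * pderiv q) (m + 2) t) (at t)"
proof -
  consider "poly q t > 0" | "poly q t < 0" | "poly q t = 0" by linarith
  then show ?thesis
  proof cases
    case 1
    let ?f = "\<lambda>t. poly P t * (inverse (poly q t) ^ m * exp (- inverse (poly q t)))"
    have ev: "\<forall>\<^sub>F x in nhds t. flat_fun q P m x = ?f x"
    proof -
      have "\<forall>\<^sub>F x in nhds t. poly q x > 0"
        by (rule order_tendstoD(1)[OF _ 1]) (auto intro: tendsto_poly filterlim_ident)
      then show ?thesis
        by eventually_elim (simp add: flat_fun_def field_simps)
    qed
    have *: "(?f has_real_derivative
       flat_fun q (pderiv P * q ^ 2 - of_nat m * P * pderiv q * q + P * pderiv q) (m + 2) t) (at t)"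
    proof (cases m)
      case 0
      show ?thesis
        unfolding 0 using 1
        by (auto intro!: derivative_eq_intros simp: flat_fun_def exp_minus field_simps power2_eq_square)
    next
      case (Suc j)
      show ?thesis
        unfolding Suc using 1
        by (auto intro!: derivative_eq_intros simp: flat_fun_def exp_minus field_simps power2_eq_square) (cases j; simp)
    qed
    then show ?thesis
      using DERIV_cong_ev[OF refl ev refl] by blast
  next
    case 2
    have ev: "\<forall>\<^sub>F x in nhds t. flat_fun q P m x = 0"
    proof -
      have "\<forall>\<^sub>F x in nhds t. poly q x < 0"
        by (rule order_tendstoD(2)[OF _ 2]) (auto intro: tendsto_poly filterlim_ident)
      then show ?thesis
        by eventually_elim (simp add: flat_fun_def)
    qed
    have "flat_fun q (pderiv P * q ^ 2 - of_nat m * P * pderiv q * q + P * pderiv q) (m + 2) t = 0"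
      using 2 by (simp add: flat_fun_def)
    then show ?thesis
      using DERIV_cong_ev[OF refl ev refl] by simp
  next
    case 3
    \<comment> \<open>The power \<open>m + 2\<close> absorbs the denominator \<open>q^m\<close> and leaves the factor \<open>q^2\<close>.\<close>
    define C where "C = real (Suc (m + 1)) ^ Suc (m + 1)"
    have bound: "\<bar>flat_fun q P m y\<bar> \<le> C * \<bar>poly P y\<bar> * \<bar>poly q y\<bar> * \<bar>poly q y\<bar>" for y
    proof (cases "poly q y > 0")
      case True
      have "exp (- 1 / poly q y) \<le> C * (poly q y ^ m * (poly q y)\<^sup>2)"
        using exp_minus_inverse_le_power[OF True, of "m + 1"] unfolding C_def
        by (simp only: flip: power_add) simp
      then have "exp (- 1 / poly q y) / poly q y ^ m \<le> C * (poly q y)\<^sup>2"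
        using True by (simp add: field_simps)
      then have "\<bar>poly P y\<bar> * (exp (- 1 / poly q y) / poly q y ^ m) \<le> \<bar>poly P y\<bar> * (C * (poly q y)\<^sup>2)"
        by (rule mult_left_mono) simp
      then show ?thesis
        using True by (simp add: flat_fun_def abs_mult power2_eq_square mult_ac)
    next
      case False
      have "0 \<le> C * \<bar>poly P y\<bar> * \<bar>poly q y\<bar> * \<bar>poly q y\<bar>"
        unfolding C_def by (intro mult_nonneg_nonneg) auto
      then show ?thesis using False by (simp add: flat_fun_def)
    qed
    have lim: "((\<lambda>y. C * \<bar>poly P y\<bar> * \<bar>poly q y\<bar> * \<bar>(poly q y - poly q t) / (y - t)\<bar>)
            \<longlongrightarrow> C * \<bar>poly P t\<bar> * \<bar>poly q t\<bar> * \<bar>poly (pderiv q) t\<bar>) (at t)"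
      using poly_DERIV[of q t] unfolding has_field_derivative_iff
      by (intro tendsto_intros tendsto_poly) auto
    have "((\<lambda>y. (flat_fun q P m y - flat_fun q P m t) / (y - t)) \<longlongrightarrow> 0) (at t)"
    proof (rule Lim_null_comparison)
      show "\<forall>\<^sub>F y in at t. norm ((flat_fun q P m y - flat_fun q P m t) / (y - t))
          \<le> C * \<bar>poly P y\<bar> * \<bar>poly q y\<bar> * \<bar>(poly q y - poly q t) / (y - t)\<bar>"
      proof (intro always_eventually allI)
        fix y
        show "norm ((flat_fun q P m y - flat_fun q P m t) / (y - t))
          \<le> C * \<bar>poly P y\<bar> * \<bar>poly q y\<bar> * \<bar>(poly q y - poly q t) / (y - t)\<bar>"
          using divide_right_mono[OF bound[of y], of "\<bar>y - t\<bar>"] 3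
          by (simp add: flat_fun_def abs_divide)
      qed
      show "((\<lambda>y. C * \<bar>poly P y\<bar> * \<bar>poly q y\<bar> * \<bar>(poly q y - poly q t) / (y - t)\<bar>) \<longlongrightarrow> 0) (at t)"
        using lim 3 by simp
    qed
    then show ?thesis
      using 3 by (simp add: has_field_derivative_iff flat_fun_def)
  qed
qed

definition tensor :: "('n::finite \<Rightarrow> real \<Rightarrow> real) \<Rightarrow> real^'n \<Rightarrow> real" where
  "tensor G x = (\<Prod>i\<in>UNIV. G i (x $ i))"

lemma tensor_partial:
  fixes G :: "'n::finite \<Rightarrow> real \<Rightarrow> real"
  assumes "\<And>i t. (G i has_real_derivative G' i t) (at t)"
  shows "tensor G differentiable (at x)" "partial j (tensor G) x = tensor (G(j := G' j)) x"
proof -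
  have 1: "((\<lambda>x. G i (x $ i)) has_derivative (\<lambda>y. y $ i * G' i (x $ i))) (at x)" for i
  proof -
    have "((\<lambda>x. G i (x $ i)) has_derivative (\<lambda>y. G' i (x $ i) * (y $ i))) (at x)"
      by (rule has_derivative_compose[OF bounded_linear.has_derivative[OF bounded_linear_vec_nth
          has_derivative_ident] assms[unfolded has_field_derivative_def]])
    then show ?thesis by (simp add: mult.commute)
  qed
  have D: "(tensor G has_derivative
      (\<lambda>y. \<Sum>i\<in>UNIV. (y $ i * G' i (x $ i)) * (\<Prod>j\<in>UNIV - {i}. G j (x $ j)))) (at x)"
    unfolding tensor_def[abs_def] by (intro has_derivative_prod 1)
  then show "tensor G differentiable (at x)" by (auto simp: differentiable_def)
  have "partial j (tensor G) x
     = (\<Sum>i\<in>UNIV. (axis j 1 $ i * G' i (x $ i)) * (\<Prod>j\<in>UNIV - {i}. G j (x $ j)))"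
    unfolding partial_def frechet_derivative_at[OF D, symmetric] ..
  also have "\<dots> = (\<Sum>i\<in>UNIV. if i = j then G' j (x $ j) * (\<Prod>j\<in>UNIV - {j}. G j (x $ j)) else 0)"
    by (intro sum.cong) (auto simp: axis_def)
  also have "\<dots> = G' j (x $ j) * (\<Prod>i\<in>UNIV - {j}. G i (x $ i))"
    by simp
  also have "\<dots> = tensor (G(j := G' j)) x"
    unfolding tensor_def by (subst (2) prod.remove[of _ j]) (auto intro!: prod.cong)
  finally show "partial j (tensor G) x = tensor (G(j := G' j)) x" .
qed

text \<open>A partial derivative changes one factor of the product and leaves it inside the family of
  \<open>flat_fun_deriv\<close>.\<close>
lemma smooth_tensor_flat_fun:
  "smooth (tensor (\<lambda>i. flat_fun (q i) (P i) (m i)))"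
proof -
  have *: "\<exists>P m. iter_partial ks (tensor (\<lambda>i. flat_fun (q i) (P0 i) (m0 i)))
      = tensor (\<lambda>i. flat_fun (q i) (P i) (m i))" for ks P0 m0
  proof (induction ks)
    case (Cons k ks)
    then obtain P m where *: "iter_partial ks (tensor (\<lambda>i. flat_fun (q i) (P0 i) (m0 i)))
      = tensor (\<lambda>i. flat_fun (q i) (P i) (m i))" by blast
    let ?P = "\<lambda>i. pderiv (P i) * q i ^ 2 - of_nat (m i) * P i * pderiv (q i) * q i + P i * pderiv (q i)"
    have "partial k (tensor (\<lambda>i. flat_fun (q i) (P i) (m i)))
        = tensor ((\<lambda>i. flat_fun (q i) (P i) (m i))(k := flat_fun (q k) (?P k) (m k + 2)))"
      by (rule ext, rule tensor_partial, rule flat_fun_deriv)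
    also have "\<dots> = tensor (\<lambda>i. flat_fun (q i) ((P(k := ?P k)) i) ((m(k := m k + 2)) i))"
      by (intro arg_cong[where f = tensor]) auto
    finally show ?case unfolding iter_partial.simps * by blast
  qed auto
  show ?thesis
    unfolding smooth_def
  proof (intro allI)
    fix ks x
    obtain P' m' where "iter_partial ks (tensor (\<lambda>i. flat_fun (q i) (P i) (m i)))
        = tensor (\<lambda>i. flat_fun (q i) (P' i) (m' i))"
      using * by blast
    then show "iter_partial ks (tensor (\<lambda>i. flat_fun (q i) (P i) (m i))) differentiable at x"
      using tensor_partial(1)[OF flat_fun_deriv] by simp
  qed
qed

text \<open>The bump is the product over the coordinates of \<open>exp (-1/q)\<close> with \<open>q(t) = k (t - a) (b - t)\<close>; the factor \<open>k\<close> drives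
  the exponent to 0 inside the box.  The properties listed are those that dominated convergence
  requires.\<close>
lemma box_bump:
  fixes a b :: "real^'n::finite"
  obtains \<phi> :: "nat \<Rightarrow> real^'n \<Rightarrow> real"
  where "\<And>k. smooth (\<phi> k)" "\<And>k x. 0 \<le> \<phi> k x \<and> \<phi> k x \<le> 1" "\<And>k x. x \<notin> box a b \<Longrightarrow> \<phi> k x = 0"
    "\<And>x. x \<in> box a b \<Longrightarrow> (\<lambda>k. \<phi> k x) \<longlonglongrightarrow> 1"
proof
  define Q where "Q = (\<lambda>k i. smult (real (Suc k)) ([:- a $ i, 1:] * [:b $ i, -1:]))"
  \<comment> \<open>If \<open>a $ i > b $ i\<close>, then \<open>Q k i\<close> is positive between \<open>b $ i\<close> and \<open>a $ i\<close>, although the box is empty; hence the 0.\<close>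
  define \<phi> where "\<phi> = (\<lambda>k. tensor (\<lambda>i. flat_fun (if a $ i \<le> b $ i then Q k i else 0) 1 0))"
  have Q: "poly (Q k i) t = real (Suc k) * ((t - a $ i) * (b $ i - t))" for k i t
    by (simp add: Q_def algebra_simps)
  have pos: "poly (if a $ i \<le> b $ i then Q k i else 0) t > 0 \<longleftrightarrow> a $ i < t \<and> t < b $ i" for k i t
    by (auto simp: Q zero_less_mult_iff)
  show "smooth (\<phi> k)" for k
    unfolding \<phi>_def by (rule smooth_tensor_flat_fun)
  show "0 \<le> \<phi> k x \<and> \<phi> k x \<le> 1" for k x
    unfolding \<phi>_def tensor_def
    by (intro conjI prod_nonneg prod_le_1) (auto simp: flat_fun_def simp del: poly_smult)
  show "\<phi> k x = 0" if x: "x \<notin> box a b" for k x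
  proof -
    obtain i where "\<not> (a $ i < x $ i \<and> x $ i < b $ i)"
      using x by (auto simp: mem_box_cart)
    then have "flat_fun (if a $ i \<le> b $ i then Q k i else 0) 1 0 (x $ i) = 0"
      by (simp only: flat_fun_def pos) simp
    then show ?thesis
      unfolding \<phi>_def tensor_def by (intro prod_zero[OF finite]) blast
  qed
  show "(\<lambda>k. \<phi> k x) \<longlonglongrightarrow> 1" if x: "x \<in> box a b" for x
  proof -
    have "(\<lambda>k. flat_fun (if a $ i \<le> b $ i then Q k i else 0) 1 0 (x $ i)) \<longlonglongrightarrow> 1" for i
    proof -
      define c where "c = (x $ i - a $ i) * (b $ i - x $ i)"
      have i: "a $ i < x $ i" "x $ i < b $ i" using x by (auto simp: mem_box_cart)
      then have "c > 0" by (simp add: c_def)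
      have eq: "flat_fun (if a $ i \<le> b $ i then Q k i else 0) 1 0 (x $ i)
          = exp (- (inverse (real (Suc k)) * inverse c))" for k
        using i unfolding flat_fun_def pos
        by (simp add: Q flip: c_def del: of_nat_Suc) (simp add: field_simps)
      have "(\<lambda>k. exp (- (inverse (real (Suc k)) * inverse c))) \<longlonglongrightarrow> exp (- (0 * inverse c))"
        by (intro tendsto_intros LIMSEQ_inverse_real_of_nat)
      then show ?thesis unfolding eq by simp
    qed
    then show ?thesis
      unfolding \<phi>_def tensor_def using tendsto_prod[of UNIV _ "\<lambda>i. 1::real"] by fastforce
  qed
qed

section \<open>The fundamental lemma of the calculus of variations\<close>

lemma vanishing_partial:
  assumes "open U" "\<And>x. x \<in> U \<Longrightarrow> \<phi> x = 0" "x \<in> U"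
  shows "partial i \<phi> x = 0"
proof -
  have "(\<phi> has_derivative (\<lambda>_. 0)) (at x)"
    by (rule has_derivative_transform_within_open[OF has_derivative_const[of 0] assms(1,3)])
       (simp add: assms(2))
  then show ?thesis
    unfolding partial_def by (simp add: frechet_derivative_at[symmetric])
qed

lemma vanishing_iter_partial:
  assumes "open U" "\<And>x. x \<in> U \<Longrightarrow> \<phi> x = 0" "x \<in> U"
  shows "iter_partial ks \<phi> x = 0"
  using assms(3)
proof (induction ks arbitrary: x)
  case (Cons k ks)
  show ?case
    using vanishing_partial[OF assms(1) Cons.IH Cons.prems] by simp
qed (simp add: assms(2))

lemma integrable_mult_compactly_supported:
  fixes w \<psi> :: "real^'n::finite \<Rightarrow> real"
  assumes w: "locally_integrable \<Omega> w" and \<Omega>: "\<Omega> \<in> sets lebesgue" and K: "compact K" "K \<subseteq> \<Omega>"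
    and \<psi>: "continuous_on UNIV \<psi>" "\<And>x. x \<notin> K \<Longrightarrow> \<psi> x = 0"
  shows "integrable (lebesgue_on \<Omega>) (\<lambda>x. w x * \<psi> x)"
proof -
  have Ks: "K \<in> sets lebesgue" using K(1) by (simp add: borel_compact)
  have wK: "integrable (lebesgue_on K) w"
    using w K by (simp add: locally_integrable_def)
  have \<psi>K: "continuous_on K \<psi>" using \<psi>(1) continuous_on_subset by blast
  obtain C where C: "\<And>x. x \<in> K \<Longrightarrow> \<bar>\<psi> x\<bar> \<le> C"
    using compact_imp_bounded[OF compact_continuous_image[OF \<psi>K K(1)]]
    by (auto simp: bounded_iff)
  have "integrable (lebesgue_on K) (\<lambda>x. w x * \<psi> x)"
  proof (rule Bochner_Integration.integrable_bound)
    show "integrable (lebesgue_on K) (\<lambda>x. C * w x)" using wK by simp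
    show "(\<lambda>x. w x * \<psi> x) \<in> borel_measurable (lebesgue_on K)"
      using continuous_imp_measurable_on_sets_lebesgue[OF \<psi>K Ks] wK
      by (intro borel_measurable_times) auto
    show "AE x in lebesgue_on K. norm (w x * \<psi> x) \<le> norm (C * w x)"
    proof (rule AE_I2)
      fix x assume "x \<in> space (lebesgue_on K)"
      then have "\<bar>\<psi> x\<bar> \<le> \<bar>C\<bar>" using C[of x] by simp
      then have "\<bar>w x\<bar> * \<bar>\<psi> x\<bar> \<le> \<bar>w x\<bar> * \<bar>C\<bar>" by (rule mult_left_mono) simp
      then show "norm (w x * \<psi> x) \<le> norm (C * w x)" by (simp add: abs_mult mult.commute)
    qed
  qed
  then have "integrable lebesgue (\<lambda>x. if x \<in> K then w x * \<psi> x else 0)"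
    by (simp only: Lebesgue_Measure.integrable_restrict_UNIV[OF Ks])
  also have "(\<lambda>x. if x \<in> K then w x * \<psi> x else 0) = (\<lambda>x. if x \<in> \<Omega> then w x * \<psi> x else 0)"
    using K(2) \<psi>(2) by (intro ext) auto
  finally show ?thesis
    by (simp only: Lebesgue_Measure.integrable_restrict_UNIV[OF \<Omega>])
qed

lemma integrable_mult_test_derivative:
  assumes "locally_integrable \<Omega> w" "open \<Omega>" "test_function \<Omega> \<phi>"
  shows "integrable (lebesgue_on \<Omega>) (\<lambda>x. w x * iter_partial ks \<phi> x)"
proof (rule integrable_mult_compactly_supported[OF assms(1)])
  let ?K = "closure {x. \<phi> x \<noteq> 0}"
  show "compact ?K" "?K \<subseteq> \<Omega>" using assms(3) by (auto simp: test_function_def)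
  show "\<Omega> \<in> sets lebesgue" using assms(2) by (simp add: borel_open)
  show "continuous_on UNIV (iter_partial ks \<phi>)"
    using assms(3) unfolding test_function_def smooth_def
    by (simp add: continuous_on_eq_continuous_at differentiable_imp_continuous_within)
  show "iter_partial ks \<phi> x = 0" if "x \<notin> ?K" for x
    by (rule vanishing_iter_partial[of "- ?K"]) (use that closure_subset[of "{x. \<phi> x \<noteq> 0}"] in auto)
qed

text \<open>Testing with bumps that tend to the indicator of the box; the closed box is a compact subset of
  \<open>\<Omega>\<close>, so \<open>w\<close> restricted to it is an integrable majorant.\<close>
lemma integral_cbox_eq_0_if_orthogonal_to_tests:
  fixes w :: "real^'n::finite \<Rightarrow> real"
  assumes \<Omega>: "open \<Omega>" and w: "locally_integrable \<Omega> w"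
    and zero: "\<And>\<phi>. test_function \<Omega> \<phi> \<Longrightarrow> inner_L2 \<Omega> w \<phi> = 0"
    and ab: "cbox a b \<subseteq> \<Omega>"
  shows "integral (cbox a b) w = 0"
proof -
  have \<Omega>s: "\<Omega> \<in> sets lebesgue" using \<Omega> by (simp add: borel_open)
  obtain \<phi> :: "nat \<Rightarrow> real^'n \<Rightarrow> real"
    where \<phi>: "\<And>k. smooth (\<phi> k)" "\<And>k x. 0 \<le> \<phi> k x \<and> \<phi> k x \<le> 1" "\<And>k x. x \<notin> box a b \<Longrightarrow> \<phi> k x = 0"
      "\<And>x. x \<in> box a b \<Longrightarrow> (\<lambda>k. \<phi> k x) \<longlonglongrightarrow> 1"
    using box_bump[of a b] by blast
  have test: "test_function \<Omega> (\<phi> k)" for k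
  proof -
    have "closure {x. \<phi> k x \<noteq> 0} \<subseteq> cbox a b"
    proof (rule closure_minimal[OF _ closed_cbox], rule subsetI)
      fix x assume "x \<in> {x. \<phi> k x \<noteq> 0}"
      then have "x \<in> box a b" using \<phi>(3) by blast
      then show "x \<in> cbox a b" using box_subset_cbox by blast
    qed
    moreover from this have "compact (closure {x. \<phi> k x \<noteq> 0})"
      using bounded_subset[OF bounded_cbox] closed_closure compact_eq_bounded_closed by blast
    ultimately show ?thesis
      using ab \<phi>(1)[of k] unfolding test_function_def by (intro conjI) (assumption, assumption, rule order_trans)
  qed
  have wab: "integrable (lebesgue_on (cbox a b)) w"
    using w ab by (simp add: locally_integrable_def)
  let ?w = "\<lambda>x. if x \<in> cbox a b then w x else 0"
  have wi: "integrable lebesgue ?w"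
    using wab Lebesgue_Measure.integrable_restrict_UNIV[of "cbox a b" w] by simp
  have eq: "(if x \<in> \<Omega> then w x * \<phi> k x else 0) = ?w x * \<phi> k x" for k x
  proof (cases "x \<in> cbox a b")
    case False
    then have "\<phi> k x = 0" using \<phi>(3) box_subset_cbox by blast
    then show ?thesis by simp
  qed (use ab in auto)
  have m: "(\<lambda>x. ?w x * \<phi> k x) \<in> borel_measurable lebesgue" for k
  proof (intro borel_measurable_times)
    show "?w \<in> borel_measurable lebesgue" using wi by (rule borel_measurable_integrable)
    have "continuous_on UNIV (\<phi> k)"
      using \<phi>(1)[of k, unfolded smooth_def, rule_format, of "[]"]
      by (simp add: continuous_on_eq_continuous_at differentiable_imp_continuous_within)
    then show "\<phi> k \<in> borel_measurable lebesgue"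
      using continuous_imp_measurable_on_sets_lebesgue[of UNIV "\<phi> k"]
      by (simp add: lebesgue_on_UNIV_eq)
  qed
  have "(\<lambda>k. LINT x|lebesgue. ?w x * \<phi> k x) \<longlonglongrightarrow> integral\<^sup>L lebesgue ?w"
  proof (rule integral_dominated_convergence[where w = "\<lambda>x. norm (?w x)"])
    show "?w \<in> borel_measurable lebesgue" using wi by (rule borel_measurable_integrable)
    show "integrable lebesgue (\<lambda>x. norm (?w x))" using wi by (rule integrable_norm)
    show "AE x in lebesgue. (\<lambda>k. ?w x * \<phi> k x) \<longlonglongrightarrow> ?w x"
    proof (rule AE_I')
      show "cbox a b - box a b \<in> null_sets lebesgue"
        using negligible_frontier_interval negligible_iff_null_sets by blast
      have in_box: "(\<lambda>k. ?w x * \<phi> k x) \<longlonglongrightarrow> ?w x" if "x \<in> box a b" for x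
        using tendsto_mult[OF tendsto_const \<phi>(4)[OF that], of "?w x"] unfolding mult_1_right .
      have out_box: "(\<lambda>k. ?w x * \<phi> k x) \<longlonglongrightarrow> ?w x" if "x \<notin> cbox a b" for x
        using that by simp
      show "{x \<in> space lebesgue. \<not> (\<lambda>k. ?w x * \<phi> k x) \<longlonglongrightarrow> ?w x} \<subseteq> cbox a b - box a b"
      proof (rule subsetI, rule ccontr)
        fix x assume x: "x \<in> {x \<in> space lebesgue. \<not> (\<lambda>k. ?w x * \<phi> k x) \<longlonglongrightarrow> ?w x}"
          and "x \<notin> cbox a b - box a b"
        then have "x \<in> box a b \<or> x \<notin> cbox a b" by blast
        then have "(\<lambda>k. ?w x * \<phi> k x) \<longlonglongrightarrow> ?w x"
          using in_box[of x] out_box[of x] by (rule disjE)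
        then show False using x by blast
      qed
    qed
    show "AE x in lebesgue. norm (?w x * \<phi> k x) \<le> norm (?w x)" for k
    proof (rule AE_I2)
      fix x
      have "\<bar>?w x\<bar> * \<bar>\<phi> k x\<bar> \<le> \<bar>?w x\<bar> * 1"
        using \<phi>(2)[of k x] by (intro mult_left_mono) auto
      then show "norm (?w x * \<phi> k x) \<le> norm (?w x)"
        by (simp only: real_norm_def abs_mult mult_1_right)
    qed
    show "(\<lambda>x. ?w x * \<phi> k x) \<in> borel_measurable lebesgue" for k by (rule m)
  qed
  moreover have "(LINT x|lebesgue. ?w x * \<phi> k x) = 0" for k
    using zero[OF test[of k]]
    unfolding inner_L2_def Lebesgue_Measure.integral_restrict_UNIV[OF \<Omega>s, symmetric] eq .
  ultimately have "integral\<^sup>L lebesgue ?w = 0"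
    by (simp only: LIMSEQ_const_iff)
  then have "integral\<^sup>L (lebesgue_on (cbox a b)) w = 0"
    using Lebesgue_Measure.integral_restrict_UNIV[of "cbox a b" w] by simp
  then show ?thesis
    using has_integral_integral_lebesgue_on[OF wab] by (simp add: integral_unique)
qed

text \<open>At almost every point \<open>w\<close> is the limit of its averages over small cubes with a corner at that
  point, and all these averages are 0.\<close>
lemma negligible_if_integrals_over_boxes_vanish:
  fixes w :: "real^'n::finite \<Rightarrow> real"
  assumes w: "integrable (lebesgue_on (cbox a b)) w"
    and cube: "\<And>c d. cbox c d \<subseteq> cbox a b \<Longrightarrow> integral (cbox c d) w = 0"
  shows "negligible {x \<in> cbox a b. w x \<noteq> 0}"
proof -
  let ?w = "\<lambda>x. if x \<in> cbox a b then w x else 0"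
  have "integrable lebesgue ?w"
    using Lebesgue_Measure.integrable_restrict_UNIV[of "cbox a b" w] w by simp
  then have "integrable (lebesgue_on (cbox c d)) ?w" for c d
    using integrable_mult_indicator[of "cbox c d" lebesgue ?w]
    by (subst integrable_restrict_space) simp_all
  then have int: "?w integrable_on cbox c d" for c d
    by (rule integrable_on_lebesgue_on) simp
  obtain N where N: "negligible N"
    "\<And>x e. \<lbrakk>x \<notin> N; 0 < e\<rbrakk> \<Longrightarrow> \<exists>d>0. \<forall>h. 0 < h \<and> h < d \<longrightarrow>
        norm (integral (cbox x (x + h *\<^sub>R One)) ?w /\<^sub>R h ^ DIM(real^'n) - ?w x) < e"
    by (rule integrable_ccontinuous_explicit[OF int]) (rule that; assumption)
  have "w x = 0" if x: "x \<in> box a b" "x \<notin> N" for x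
  proof (rule ccontr)
    assume "w x \<noteq> 0"
    then obtain d where d: "d > 0" "\<And>h. 0 < h \<Longrightarrow> h < d \<Longrightarrow>
        norm (integral (cbox x (x + h *\<^sub>R One)) ?w /\<^sub>R h ^ DIM(real^'n) - ?w x) < \<bar>w x\<bar>"
      using N(2)[OF x(2), of "\<bar>w x\<bar>"] by auto
    obtain r where r: "r > 0" "ball x r \<subseteq> box a b"
      using openE[OF open_box x(1)] by blast
    define n where "n = norm (One :: real^'n)"
    have n: "n > 0" unfolding n_def zero_less_norm_iff using One_non_0 by blast
    define h where "h = min (d / 2) (r / (2 * n))"
    have h: "0 < h" "h < d" "h * n < r"
      using d(1) r(1) n by (auto simp: h_def min_def field_simps)
    have sub: "cbox x (x + h *\<^sub>R One) \<subseteq> cbox a b"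
    proof -
      have "x + h *\<^sub>R One \<in> ball x r"
      proof -
        have "norm (x - (x + h *\<^sub>R v)) = \<bar>h\<bar> * norm v" for v :: "real^'n" by simp
        then show ?thesis using h(1,3) unfolding mem_ball dist_norm n_def by simp
      qed
      then have "x \<in> box a b" "x + h *\<^sub>R One \<in> box a b" using r(2) x(1) by auto
      then have "x \<in> cbox a b" "x + h *\<^sub>R One \<in> cbox a b"
        using box_subset_cbox by blast+
      then show ?thesis unfolding subset_box(1) by (simp add: mem_box)
    qed
    have "integral (cbox x (x + h *\<^sub>R One)) ?w = integral (cbox x (x + h *\<^sub>R One)) w"
      using sub by (intro Henstock_Kurzweil_Integration.integral_cong) auto
    also have "\<dots> = 0" using cube sub by blast
    finally have "norm (0 - ?w x) < \<bar>w x\<bar>"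
      using d(2)[OF h(1,2)] by simp
    moreover have "x \<in> cbox a b" using x(1) box_subset_cbox by blast
    ultimately show False by simp
  qed
  then have "{x \<in> cbox a b. w x \<noteq> 0} \<subseteq> N \<union> (cbox a b - box a b)" by auto
  then show ?thesis
    by (rule negligible_subset[OF negligible_Un[OF N(1) negligible_frontier_interval]])
qed

theorem fundamental_lemma_of_variations:
  fixes w :: "real^'n::finite \<Rightarrow> real"
  assumes \<Omega>: "open \<Omega>" and w: "locally_integrable \<Omega> w"
    and zero: "\<And>\<phi>. test_function \<Omega> \<phi> \<Longrightarrow> inner_L2 \<Omega> w \<phi> = 0"
  shows "AE x in lebesgue_on \<Omega>. w x = 0"
proof -
  have local: "negligible {x \<in> cbox a b. w x \<noteq> 0}" if ab: "cbox a b \<subseteq> \<Omega>" for a b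
  proof (rule negligible_if_integrals_over_boxes_vanish)
    show "integrable (lebesgue_on (cbox a b)) w"
      using w ab by (simp add: locally_integrable_def)
    show "integral (cbox c d) w = 0" if "cbox c d \<subseteq> cbox a b" for c d
      using integral_cbox_eq_0_if_orthogonal_to_tests[OF \<Omega> w zero] ab that by blast
  qed
  obtain D where D: "countable D" "D \<subseteq> Pow \<Omega>" "\<And>X. X \<in> D \<Longrightarrow> \<exists>a b. X = cbox a b" "\<Union>D = \<Omega>"
    by (rule open_countable_Union_open_cbox[OF \<Omega>]) (rule that)
  have "negligible (\<Union>X\<in>D. {x \<in> X. w x \<noteq> 0})"
  proof (intro negligible_countable_Union ballI)
    show "countable ((\<lambda>X. {x \<in> X. w x \<noteq> 0}) ` D)" using D(1) by (rule countable_image)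
    fix Y assume "Y \<in> (\<lambda>X. {x \<in> X. w x \<noteq> 0}) ` D"
    then obtain X where "X \<in> D" "Y = {x \<in> X. w x \<noteq> 0}" by blast
    moreover from this obtain a b where "X = cbox a b" using D(3) by blast
    ultimately show "negligible Y" using D(2) local[of a b] by auto
  qed
  moreover have "(\<Union>X\<in>D. {x \<in> X. w x \<noteq> 0}) = {x \<in> \<Omega>. w x \<noteq> 0}"
    using D(4) by auto
  ultimately have "negligible {x \<in> \<Omega>. w x \<noteq> 0}" by simp
  then have "AE x in lebesgue. x \<in> \<Omega> \<longrightarrow> w x = 0"
    unfolding negligible_iff_null_sets by (rule AE_I') blast
  then show ?thesis
    using \<Omega> by (simp add: borel_open AE_restrict_space_iff)
qed

section \<open>Weak derivatives and the second-order Sobolev seminorm\<close>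

lemma inner_L2_linear:
  fixes v w \<phi> :: "real^'n::finite \<Rightarrow> real"
  assumes "locally_integrable \<Omega> v" "locally_integrable \<Omega> w" "open \<Omega>" "test_function \<Omega> \<phi>"
  shows "inner_L2 \<Omega> (\<lambda>x. a * v x + b * w x) (iter_partial ks \<phi>)
    = a * inner_L2 \<Omega> v (iter_partial ks \<phi>) + b * inner_L2 \<Omega> w (iter_partial ks \<phi>)"
proof -
  have "inner_L2 \<Omega> (\<lambda>x. a * v x + b * w x) (iter_partial ks \<phi>)
      = (\<integral>x. a * (v x * iter_partial ks \<phi> x) + b * (w x * iter_partial ks \<phi> x) \<partial>lebesgue_on \<Omega>)"
    unfolding inner_L2_def by (intro Bochner_Integration.integral_cong refl) (simp add: algebra_simps)
  also have "\<dots> = a * inner_L2 \<Omega> v (iter_partial ks \<phi>) + b * inner_L2 \<Omega> w (iter_partial ks \<phi>)"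
    unfolding inner_L2_def
    using integrable_mult_test_derivative[OF assms(1,3,4)] integrable_mult_test_derivative[OF assms(2,3,4)]
    by simp
  finally show ?thesis .
qed

lemma locally_integrable_linear:
  assumes "locally_integrable \<Omega> v" "locally_integrable \<Omega> w"
  shows "locally_integrable \<Omega> (\<lambda>x. a * v x + b * w x)"
  using assms unfolding locally_integrable_def by simp

lemma weak_deriv_linear:
  assumes "open \<Omega>" "is_weak_deriv \<Omega> \<alpha> v v'" "is_weak_deriv \<Omega> \<alpha> w w'"
  shows "is_weak_deriv \<Omega> \<alpha> (\<lambda>x. a * v x + b * w x) (\<lambda>x. a * v' x + b * w' x)"
  unfolding is_weak_deriv_def
proof (intro conjI allI impI locally_integrable_linear)
  fix \<phi> assume \<phi>: "test_function \<Omega> \<phi>"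
  have loc: "locally_integrable \<Omega> v" "locally_integrable \<Omega> w" "locally_integrable \<Omega> v'" "locally_integrable \<Omega> w'"
    and eq: "inner_L2 \<Omega> v (multi_partial \<alpha> \<phi>) = (-1) ^ mi_order \<alpha> * inner_L2 \<Omega> v' \<phi>"
      "inner_L2 \<Omega> w (multi_partial \<alpha> \<phi>) = (-1) ^ mi_order \<alpha> * inner_L2 \<Omega> w' \<phi>"
    using assms \<phi> by (auto simp: is_weak_deriv_def)
  show "inner_L2 \<Omega> (\<lambda>x. a * v x + b * w x) (multi_partial \<alpha> \<phi>)
      = (-1) ^ mi_order \<alpha> * inner_L2 \<Omega> (\<lambda>x. a * v' x + b * w' x) \<phi>"
    using eq inner_L2_linear[OF loc(1,2) assms(1) \<phi>] inner_L2_linear[OF loc(3,4) assms(1) \<phi>, of _ _ "[]"]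
    by (simp add: multi_partial_def algebra_simps)
qed (use assms in \<open>auto simp: is_weak_deriv_def\<close>)

lemma weak_deriv_unique:
  assumes "open \<Omega>" "is_weak_deriv \<Omega> \<alpha> v w" "is_weak_deriv \<Omega> \<alpha> v w'"
  shows "AE x in lebesgue_on \<Omega>. w x = w' x"
proof -
  have loc: "locally_integrable \<Omega> w" "locally_integrable \<Omega> w'"
    using assms by (auto simp: is_weak_deriv_def)
  have "AE x in lebesgue_on \<Omega>. 1 * w x + (-1) * w' x = 0"
  proof (rule fundamental_lemma_of_variations[OF assms(1) locally_integrable_linear[OF loc]])
    fix \<phi> assume \<phi>: "test_function \<Omega> \<phi>"
    then have "(-1) ^ mi_order \<alpha> * inner_L2 \<Omega> w \<phi> = (-1) ^ mi_order \<alpha> * inner_L2 \<Omega> w' \<phi>"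
      using assms by (simp add: is_weak_deriv_def)
    then have "inner_L2 \<Omega> w \<phi> = inner_L2 \<Omega> w' \<phi>" by simp
    then show "inner_L2 \<Omega> (\<lambda>x. 1 * w x + (-1) * w' x) \<phi> = 0"
      using inner_L2_linear[OF loc assms(1) \<phi>, of 1 "-1" "[]"] by simp
  qed
  then show ?thesis by (rule AE_mp) simp
qed

lemma integrable_lebesgue_on_cong_AE:
  fixes f g :: "'a::euclidean_space \<Rightarrow> real"
  assumes S: "S \<in> sets lebesgue" and f: "integrable (lebesgue_on S) f"
    and eq: "AE x in lebesgue_on S. f x = g x"
  shows "integrable (lebesgue_on S) g"
proof -
  let ?f = "\<lambda>x. if x \<in> S then f x else 0" and ?g = "\<lambda>x. if x \<in> S then g x else 0"
  have f': "integrable lebesgue ?f"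
    using f by (simp only: Lebesgue_Measure.integrable_restrict_UNIV[OF S])
  have "AE x in lebesgue. x \<in> S \<longrightarrow> f x = g x"
    using eq S by (subst (asm) AE_restrict_space_iff) auto
  then have eq': "AE x in lebesgue. ?f x = ?g x" by (rule AE_mp) simp
  have "?g \<in> borel_measurable lebesgue"
    by (rule borel_measurable_AE[OF borel_measurable_integrable[OF f'] eq'])
  then have "integrable lebesgue ?g"
    by (rule integrable_cong_AE_imp[OF f' _ eq'[THEN AE_mp]]) simp
  then show ?thesis
    by (simp only: Lebesgue_Measure.integrable_restrict_UNIV[OF S])
qed

text \<open>The definition of \<open>Hsp\<close> provides some square integrable weak derivative, and \<open>wderiv\<close> chooses some
  weak derivative; uniqueness almost everywhere transfers the square integrability.\<close>
lemma wderiv_L2: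
  assumes "open \<Omega>" "v \<in> Hsp \<Omega> 2" "mi_order \<alpha> \<le> 2"
  shows "is_weak_deriv \<Omega> \<alpha> v (wderiv \<Omega> \<alpha> v)" "integrable (lebesgue_on \<Omega>) (\<lambda>x. (wderiv \<Omega> \<alpha> v x)\<^sup>2)"
proof -
  obtain w where w: "is_weak_deriv \<Omega> \<alpha> v w" "L2_on \<Omega> w"
    using assms(2,3) unfolding Hsp_def by auto
  show *: "is_weak_deriv \<Omega> \<alpha> v (wderiv \<Omega> \<alpha> v)"
    unfolding wderiv_def using w(1) by (rule someI[of "is_weak_deriv \<Omega> \<alpha> v"])
  have eq: "AE x in lebesgue_on \<Omega>. (w x)\<^sup>2 = (wderiv \<Omega> \<alpha> v x)\<^sup>2"
    using weak_deriv_unique[OF assms(1) w(1) *] by (rule AE_mp) simp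
  have "integrable (lebesgue_on \<Omega>) (\<lambda>x. (w x)\<^sup>2)" "\<Omega> \<in> sets lebesgue"
    using w(2) assms(1) by (simp_all add: L2_on_def borel_open)
  then show "integrable (lebesgue_on \<Omega>) (\<lambda>x. (wderiv \<Omega> \<alpha> v x)\<^sup>2)"
    by - (rule integrable_lebesgue_on_cong_AE[OF _ _ eq], assumption+)
qed

lemma wderiv_linear:
  assumes "open \<Omega>" "v \<in> Hsp \<Omega> 2" "w \<in> Hsp \<Omega> 2" "mi_order \<alpha> \<le> 2"
  shows "AE x in lebesgue_on \<Omega>.
    wderiv \<Omega> \<alpha> (\<lambda>x. a * v x + b * w x) x = a * wderiv \<Omega> \<alpha> v x + b * wderiv \<Omega> \<alpha> w x"
proof -
  have "is_weak_deriv \<Omega> \<alpha> (\<lambda>x. a * v x + b * w x) (\<lambda>x. a * wderiv \<Omega> \<alpha> v x + b * wderiv \<Omega> \<alpha> w x)"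
    using assms by (intro weak_deriv_linear wderiv_L2(1))
  moreover from this have "is_weak_deriv \<Omega> \<alpha> (\<lambda>x. a * v x + b * w x) (wderiv \<Omega> \<alpha> (\<lambda>x. a * v x + b * w x))"
    unfolding wderiv_def by (rule someI[of "is_weak_deriv \<Omega> \<alpha> (\<lambda>x. a * v x + b * w x)"])
  ultimately show ?thesis using weak_deriv_unique[OF assms(1)] by blast
qed

lemma finite_multi_indices: "finite {\<alpha> :: 'n::finite \<Rightarrow> nat. mi_order \<alpha> \<le> m}"
proof (rule finite_subset)
  show "{\<alpha> :: 'n \<Rightarrow> nat. mi_order \<alpha> \<le> m} \<subseteq> UNIV \<rightarrow>\<^sub>E {..m}"
  proof
    fix \<alpha> :: "'n \<Rightarrow> nat" assume "\<alpha> \<in> {\<alpha>. mi_order \<alpha> \<le> m}"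
    then have "\<alpha> i \<le> m" for i
      using member_le_sum[of i UNIV \<alpha>] by (simp add: mi_order_def)
    then show "\<alpha> \<in> UNIV \<rightarrow>\<^sub>E {..m}" by (intro PiE_I) simp_all
  qed
  show "finite ((UNIV :: 'n set) \<rightarrow>\<^sub>E {..m})" by (intro finite_PiE) auto
qed

definition H2_energy :: "(real^'n::finite) set \<Rightarrow> (real^'n \<Rightarrow> real) \<Rightarrow> real" where
  "H2_energy \<Omega> v = (\<Sum>\<alpha> | mi_order \<alpha> \<le> 2. \<integral>x. (wderiv \<Omega> \<alpha> v x)\<^sup>2 \<partial>lebesgue_on \<Omega>)"

lemma H2_energy_nonneg: "H2_energy \<Omega> v \<ge> 0"
  unfolding H2_energy_def by (intro sum_nonneg Bochner_Integration.integral_nonneg) auto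

lemma Hnorm_2: "Hnorm \<Omega> 2 v = sqrt (H2_energy \<Omega> v)"
  by (simp add: Hnorm_def H2_energy_def frac_def)

lemma Hnorm_nonneg: "Hnorm \<Omega> s v \<ge> 0"
proof -
  have "0 \<le> gagliardo_integrand \<Omega> \<sigma> \<alpha> v z" for \<sigma> \<alpha> z
    by (cases z) (simp add: gagliardo_integrand_def)
  then have "0 \<le> integral\<^sup>L M (gagliardo_integrand \<Omega> \<sigma> \<alpha> v)" for M \<sigma> \<alpha>
    by (rule Bochner_Integration.integral_nonneg)
  then show ?thesis
    unfolding Hnorm_def by (auto intro!: add_nonneg_nonneg sum_nonneg)
qed

text \<open>This inequality and the next lemma yield Minkowski's inequality for a sum of squared \<open>L^2\<close> norms: the
  weighted bound can be integrated and summed term by term, and optimising the weight \<open>t\<close> afterwards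
  gives the square of the sum of the norms.\<close>
lemma square_sum_weighted:
  fixes x y t :: real
  assumes "0 < t" "t < 1"
  shows "(x + y)\<^sup>2 \<le> x\<^sup>2 / t + y\<^sup>2 / (1 - t)"
proof -
  have "x\<^sup>2 / t + y\<^sup>2 / (1 - t) - (x + y)\<^sup>2 = ((1 - t) * x - t * y)\<^sup>2 / (t * (1 - t))"
    using assms by (simp add: divide_simps) (simp add: algebra_simps power2_eq_square)
  also have "\<dots> \<ge> 0" using assms by simp
  finally show ?thesis by simp
qed

lemma square_le_if_weighted_bounds:
  fixes A B S :: real
  assumes "A \<ge> 0" "B \<ge> 0" "\<And>t. 0 < t \<Longrightarrow> t < 1 \<Longrightarrow> S \<le> A\<^sup>2 / t + B\<^sup>2 / (1 - t)"
  shows "S \<le> (A + B)\<^sup>2"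
proof -
  have "S \<le> (A + B) * (A + B + 2 * e)" if "e > 0" for e
  proof -
    \<comment> \<open>The optimal weight is \<open>A / (A + B)\<close>; the shift by \<open>e\<close> keeps it inside \<open>(0, 1)\<close> when \<open>A\<close> or \<open>B\<close> is 0.\<close>
    define t where "t = (A + e) / (A + B + 2 * e)"
    have t: "0 < t" "t < 1" "1 - t = (B + e) / (A + B + 2 * e)"
      using assms that by (auto simp: t_def field_simps)
    have "A\<^sup>2 / t = (A\<^sup>2 / (A + e)) * (A + B + 2 * e)" by (simp add: t_def)
    also have "\<dots> \<le> A * (A + B + 2 * e)"
      using assms that by (intro mult_right_mono) (auto simp: divide_simps power2_eq_square algebra_simps)
    finally have 1: "A\<^sup>2 / t \<le> A * (A + B + 2 * e)" .
    have "B\<^sup>2 / (1 - t) = (B\<^sup>2 / (B + e)) * (A + B + 2 * e)" by (simp add: t(3))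
    also have "\<dots> \<le> B * (A + B + 2 * e)"
      using assms that by (intro mult_right_mono) (auto simp: divide_simps power2_eq_square algebra_simps)
    finally show ?thesis using 1 assms(3)[OF t(1,2)] by (simp add: algebra_simps)
  qed
  moreover have "((\<lambda>e. (A + B) * (A + B + 2 * e)) \<longlongrightarrow> (A + B) * (A + B + 2 * 0)) (at_right 0)"
    by (intro tendsto_intros)
  ultimately have "S \<le> (A + B) * (A + B + 2 * 0)"
    by (intro tendsto_lowerbound[of _ _ "at_right 0"]) (auto simp: eventually_at_right_less eventually_at_filter)
  then show ?thesis by (simp add: power2_eq_square)
qed

lemma Hnorm_2_combination_le:
  assumes "open \<Omega>" "v \<in> Hsp \<Omega> 2" "w \<in> Hsp \<Omega> 2"
  shows "Hnorm \<Omega> 2 (\<lambda>x. a * v x + b * w x) \<le> \<bar>a\<bar> * Hnorm \<Omega> 2 v + \<bar>b\<bar> * Hnorm \<Omega> 2 w"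
proof -
  let ?A = "\<bar>a\<bar> * Hnorm \<Omega> 2 v" and ?B = "\<bar>b\<bar> * Hnorm \<Omega> 2 w"
  have "H2_energy \<Omega> (\<lambda>x. a * v x + b * w x) \<le> (?A + ?B)\<^sup>2"
  proof (rule square_le_if_weighted_bounds)
    fix t :: real assume t: "0 < t" "t < 1"
    have "(\<integral>x. (wderiv \<Omega> \<alpha> (\<lambda>x. a * v x + b * w x) x)\<^sup>2 \<partial>lebesgue_on \<Omega>)
        \<le> a\<^sup>2 / t * (\<integral>x. (wderiv \<Omega> \<alpha> v x)\<^sup>2 \<partial>lebesgue_on \<Omega>)
          + b\<^sup>2 / (1 - t) * (\<integral>x. (wderiv \<Omega> \<alpha> w x)\<^sup>2 \<partial>lebesgue_on \<Omega>)"
      if \<alpha>: "mi_order \<alpha> \<le> 2" for \<alpha>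
    proof -
      note int = wderiv_L2(2)[OF assms(1,2) \<alpha>] wderiv_L2(2)[OF assms(1,3) \<alpha>]
      have "(\<integral>x. (wderiv \<Omega> \<alpha> (\<lambda>x. a * v x + b * w x) x)\<^sup>2 \<partial>lebesgue_on \<Omega>)
        \<le> (\<integral>x. a\<^sup>2 / t * (wderiv \<Omega> \<alpha> v x)\<^sup>2 + b\<^sup>2 / (1 - t) * (wderiv \<Omega> \<alpha> w x)\<^sup>2 \<partial>lebesgue_on \<Omega>)"
      proof (rule integral_mono_AE')
        show "AE x in lebesgue_on \<Omega>. (wderiv \<Omega> \<alpha> (\<lambda>x. a * v x + b * w x) x)\<^sup>2
            \<le> a\<^sup>2 / t * (wderiv \<Omega> \<alpha> v x)\<^sup>2 + b\<^sup>2 / (1 - t) * (wderiv \<Omega> \<alpha> w x)\<^sup>2"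
          using wderiv_linear[OF assms \<alpha>, of a b]
        proof (rule AE_mp, intro AE_I2 impI)
          fix x assume "wderiv \<Omega> \<alpha> (\<lambda>x. a * v x + b * w x) x = a * wderiv \<Omega> \<alpha> v x + b * wderiv \<Omega> \<alpha> w x"
          then show "(wderiv \<Omega> \<alpha> (\<lambda>x. a * v x + b * w x) x)\<^sup>2
            \<le> a\<^sup>2 / t * (wderiv \<Omega> \<alpha> v x)\<^sup>2 + b\<^sup>2 / (1 - t) * (wderiv \<Omega> \<alpha> w x)\<^sup>2"
            using square_sum_weighted[OF t, of "a * wderiv \<Omega> \<alpha> v x" "b * wderiv \<Omega> \<alpha> w x"]
            by (simp add: power_mult_distrib)
        qed
      qed (use int t in auto)
      also have "\<dots> = a\<^sup>2 / t * (\<integral>x. (wderiv \<Omega> \<alpha> v x)\<^sup>2 \<partial>lebesgue_on \<Omega>)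
          + b\<^sup>2 / (1 - t) * (\<integral>x. (wderiv \<Omega> \<alpha> w x)\<^sup>2 \<partial>lebesgue_on \<Omega>)"
        using int by simp
      finally show ?thesis .
    qed
    then have "H2_energy \<Omega> (\<lambda>x. a * v x + b * w x)
        \<le> (\<Sum>\<alpha> | mi_order \<alpha> \<le> 2. a\<^sup>2 / t * (\<integral>x. (wderiv \<Omega> \<alpha> v x)\<^sup>2 \<partial>lebesgue_on \<Omega>)
          + b\<^sup>2 / (1 - t) * (\<integral>x. (wderiv \<Omega> \<alpha> w x)\<^sup>2 \<partial>lebesgue_on \<Omega>))"
      unfolding H2_energy_def by (intro sum_mono) simp
    also have "\<dots> = a\<^sup>2 / t * H2_energy \<Omega> v + b\<^sup>2 / (1 - t) * H2_energy \<Omega> w"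
      by (simp only: H2_energy_def sum.distrib sum_distrib_left)
    also have "\<dots> = ?A\<^sup>2 / t + ?B\<^sup>2 / (1 - t)"
      by (simp add: Hnorm_2 power_mult_distrib H2_energy_nonneg)
    finally show "H2_energy \<Omega> (\<lambda>x. a * v x + b * w x) \<le> ?A\<^sup>2 / t + ?B\<^sup>2 / (1 - t)" .
  qed (simp_all add: Hnorm_nonneg)
  then show ?thesis
    unfolding Hnorm_2[of \<Omega> "\<lambda>x. a * v x + b * w x"]
    by (intro real_le_lsqrt) (simp_all add: Hnorm_nonneg H2_energy_nonneg)
qed

lemma wderiv_AE_0_if_Hnorm_2_0:
  assumes "open \<Omega>" "v \<in> Hsp \<Omega> 2" "Hnorm \<Omega> 2 v = 0" "mi_order \<alpha> \<le> 2"
  shows "AE x in lebesgue_on \<Omega>. wderiv \<Omega> \<alpha> v x = 0"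
proof -
  have "H2_energy \<Omega> v = 0" using assms(3) by (simp add: Hnorm_2)
  then have "(\<integral>x. (wderiv \<Omega> \<alpha> v x)\<^sup>2 \<partial>lebesgue_on \<Omega>) = 0"
    unfolding H2_energy_def using assms(4)
    by (subst (asm) sum_nonneg_eq_0_iff) (auto simp: finite_multi_indices intro: Bochner_Integration.integral_nonneg)
  then have "AE x in lebesgue_on \<Omega>. (wderiv \<Omega> \<alpha> v x)\<^sup>2 = 0"
    using integral_nonneg_eq_0_iff_AE[OF wderiv_L2(2)[OF assms(1,2,4)]] by simp
  then show ?thesis by simp
qed

lemma mi_order_mi_unit: "mi_order (mi_unit i) = 1"
  by (simp add: mi_order_def mi_unit_def)

lemma mi_order_mi_unit_add: "mi_order (\<lambda>k. mi_unit i k + mi_unit j k) = 2"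
  using mi_order_mi_unit[of i] mi_order_mi_unit[of j] by (simp add: mi_order_def sum.distrib)

text \<open>Laplacian and gradient of \<open>v\<close> are built from weak derivatives of order at most two, which vanish almost
  everywhere.  This is what makes the form blind to the difference between a fixed point up to
  seminorm zero and a genuine one.\<close>
lemma lin_form_0_if_Hnorm_2_0:
  assumes "open \<Omega>" "v \<in> Hsp \<Omega> 2" "Hnorm \<Omega> 2 v = 0"
  shows "lin_form \<Omega> \<epsilon> u v w = 0"
proof -
  have D2: "AE x in lebesgue_on \<Omega>. \<forall>i\<in>UNIV. wderiv \<Omega> (\<lambda>k. mi_unit i k + mi_unit i k) v x = 0"
    by (intro AE_finite_allI wderiv_AE_0_if_Hnorm_2_0[OF assms]) (auto simp: mi_order_mi_unit_add)
  have D1: "AE x in lebesgue_on \<Omega>. \<forall>i\<in>UNIV. wderiv \<Omega> (mi_unit i) v x = 0"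
    by (intro AE_finite_allI wderiv_AE_0_if_Hnorm_2_0[OF assms]) (auto simp: mi_order_mi_unit)
  have "AE x in lebesgue_on \<Omega>. laplacian \<Omega> v x * laplacian \<Omega> w x = 0"
    using D2 by (rule AE_mp) (simp add: laplacian_def hessian_def)
  moreover have "AE x in lebesgue_on \<Omega>. (cof (hessian \<Omega> u x) *v grad \<Omega> v x) \<bullet> grad \<Omega> w x = 0"
    using D1
  proof (rule AE_mp, intro AE_I2 impI)
    fix x assume "\<forall>i\<in>UNIV. wderiv \<Omega> (mi_unit i) v x = 0"
    then have "grad \<Omega> v x = 0" by (simp add: grad_def vec_eq_iff)
    then show "(cof (hessian \<Omega> u x) *v grad \<Omega> v x) \<bullet> grad \<Omega> w x = 0" by simp
  qed
  ultimately show ?thesis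
    unfolding lin_form_def by (simp add: integral_eq_zero_AE)
qed

section \<open>Contractions in finite-dimensional seminormed spaces\<close>

locale seminormed_function_space =
  fixes S :: "('a \<Rightarrow> real) set" and p :: "('a \<Rightarrow> real) \<Rightarrow> real"
  assumes zero_mem: "(\<lambda>x. 0) \<in> S"
    and comb_mem: "v \<in> S \<Longrightarrow> w \<in> S \<Longrightarrow> (\<lambda>x. a * v x + b * w x) \<in> S"
    and nonneg: "v \<in> S \<Longrightarrow> 0 \<le> p v"
    and comb_le: "v \<in> S \<Longrightarrow> w \<in> S \<Longrightarrow> p (\<lambda>x. a * v x + b * w x) \<le> \<bar>a\<bar> * p v + \<bar>b\<bar> * p w"
begin

lemma add_mem: "v \<in> S \<Longrightarrow> w \<in> S \<Longrightarrow> (\<lambda>x. v x + w x) \<in> S"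
  using comb_mem[of v w 1 1] by simp

lemma diff_mem: "v \<in> S \<Longrightarrow> w \<in> S \<Longrightarrow> (\<lambda>x. v x - w x) \<in> S"
  using comb_mem[of v w 1 "-1"] by simp

lemma scale_mem: "v \<in> S \<Longrightarrow> (\<lambda>x. a * v x) \<in> S"
  using comb_mem[of v v a 0] by simp

lemma add_scaled_mem: "v \<in> S \<Longrightarrow> w \<in> S \<Longrightarrow> (\<lambda>x. v x + b * w x) \<in> S"
  using comb_mem[of v w 1 b] by simp

lemma add_scaled_le: "v \<in> S \<Longrightarrow> w \<in> S \<Longrightarrow> p (\<lambda>x. v x + b * w x) \<le> p v + \<bar>b\<bar> * p w"
  using comb_le[of v w 1 b] by simp

lemma scale_le: "v \<in> S \<Longrightarrow> p (\<lambda>x. a * v x) \<le> \<bar>a\<bar> * p v"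
  using comb_le[of v v a 0] by simp

lemma zero: "p (\<lambda>x. 0) = 0"
  using scale_le[OF zero_mem, of 0] nonneg[OF zero_mem] by simp

lemma diff_commute_le: "v \<in> S \<Longrightarrow> w \<in> S \<Longrightarrow> p (\<lambda>x. v x - w x) \<le> p (\<lambda>x. w x - v x)"
  using scale_le[OF diff_mem[of w v], of "-1"] by simp

lemma triangle:
  "u \<in> S \<Longrightarrow> v \<in> S \<Longrightarrow> w \<in> S \<Longrightarrow> p (\<lambda>x. u x - w x) \<le> p (\<lambda>x. u x - v x) + p (\<lambda>x. v x - w x)"
  using comb_le[OF diff_mem[of u v] diff_mem[of v w], of 1 1] by simp

lemma subspaceI:
  assumes "S' \<subseteq> S" "(\<lambda>x. 0) \<in> S'" "\<And>v w a b. v \<in> S' \<Longrightarrow> w \<in> S' \<Longrightarrow> (\<lambda>x. a * v x + b * w x) \<in> S'"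
  shows "seminormed_function_space S' p"
proof
  show "p (\<lambda>x. a * v x + b * w x) \<le> \<bar>a\<bar> * p v + \<bar>b\<bar> * p w" if "v \<in> S'" "w \<in> S'" for v w a b
    using that assms(1) by (intro comb_le) auto
qed (use assms nonneg in auto)

end

definition span_of :: "'i set \<Rightarrow> ('i \<Rightarrow> 'a \<Rightarrow> real) \<Rightarrow> ('a \<Rightarrow> real) set" where
  "span_of I e = {\<lambda>x. \<Sum>i\<in>I. c i * e i x | c. True}"

lemma span_ofI: "v = (\<lambda>x. \<Sum>i\<in>I. c i * e i x) \<Longrightarrow> v \<in> span_of I e"
  by (auto simp: span_of_def)

lemma span_of_combination:
  assumes "v \<in> span_of I e" "w \<in> span_of I e"
  shows "(\<lambda>x. a * v x + b * w x) \<in> span_of I e"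
proof -
  obtain c d where "v = (\<lambda>x. \<Sum>i\<in>I. c i * e i x)" "w = (\<lambda>x. \<Sum>i\<in>I. d i * e i x)"
    using assms by (auto simp: span_of_def)
  then show ?thesis
    by (intro span_ofI[where c = "\<lambda>i. a * c i + b * d i"])
       (simp add: sum.distrib sum_distrib_left algebra_simps)
qed

lemma zero_in_span_of: "(\<lambda>x. 0) \<in> span_of I e"
  by (rule span_ofI[where c = "\<lambda>_. 0"]) simp

text \<open>Induction on the spanning family.  If \<open>S\<close> uses the new generator, choose \<open>s \<in> S\<close> with a nonzero
  coefficient there; then every element of \<open>S\<close> is \<open>y + d s\<close> with \<open>y\<close> in the smaller space \<open>S'\<close>.  Either \<open>s\<close> has
  positive distance from \<open>S'\<close>: then the coefficients \<open>d\<close> of a Cauchy sequence are themselves Cauchy.  Or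
  the distance is 0: then, \<open>S'\<close> being complete, \<open>s\<close> is at distance exactly 0 from some element of
  \<open>S'\<close>, and \<open>s\<close> may be replaced by that element.\<close>
theorem finite_dimensional_complete:
  fixes p :: "('a \<Rightarrow> real) \<Rightarrow> real" and X :: "nat \<Rightarrow> 'a \<Rightarrow> real"
  assumes "finite I" "seminormed_function_space S p" "S \<subseteq> span_of I e"
    and "\<And>k. X k \<in> S" "\<forall>\<epsilon>>0. \<exists>N. \<forall>m\<ge>N. \<forall>n\<ge>N. p (\<lambda>x. X m x - X n x) < \<epsilon>"
  shows "\<exists>z\<in>S. (\<lambda>k. p (\<lambda>x. X k x - z x)) \<longlonglongrightarrow> 0"
  using assms
proof (induction I arbitrary: S X rule: finite_induct)
  case empty
  interpret seminormed_function_space S p by fact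
  have "X k = (\<lambda>x. 0)" for k
    using empty.prems(2,3) by (auto simp: span_of_def)
  then show ?case
    by (intro bexI[OF _ zero_mem]) (simp add: zero)
next
  case (insert i I)
  interpret seminormed_function_space S p by fact
  show ?case
  proof (cases "S \<subseteq> span_of I e")
    case True
    then show ?thesis using insert.IH insert.prems by blast
  next
    case False
    define S' where "S' = S \<inter> span_of I e"
    interpret S': seminormed_function_space S' p
      unfolding S'_def
      by (rule subspaceI) (auto simp: zero_mem zero_in_span_of comb_mem span_of_combination)
    have S'S: "v \<in> S" if "v \<in> S'" for v using that by (simp add: S'_def)
    have IH: "\<exists>z\<in>S'. (\<lambda>k. p (\<lambda>x. Y k x - z x)) \<longlonglongrightarrow> 0"
      if "\<And>k. Y k \<in> S'" "\<forall>\<epsilon>>0. \<exists>N. \<forall>m\<ge>N. \<forall>n\<ge>N. p (\<lambda>x. Y m x - Y n x) < \<epsilon>" for Y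
      using insert.IH[OF S'.seminormed_function_space_axioms _ that] by (simp add: S'_def)
    have decomp: "\<exists>c w. w \<in> span_of I e \<and> v = (\<lambda>x. c * e i x + w x)" if v: "v \<in> S" for v
    proof -
      obtain c where "v = (\<lambda>x. \<Sum>j\<in>insert i I. c j * e j x)"
        using subsetD[OF insert.prems(2) v] by (auto simp: span_of_def)
      then show ?thesis
        using insert.hyps by (intro exI[of _ "c i"] exI[of _ "\<lambda>x. \<Sum>j\<in>I. c j * e j x"])
          (auto simp: span_of_def)
    qed
    obtain s where s: "s \<in> S" "s \<notin> span_of I e" using False by blast
    obtain c0 w0 where c0: "w0 \<in> span_of I e" "s = (\<lambda>x. c0 * e i x + w0 x)"
      using decomp[OF s(1)] by blast
    have "c0 \<noteq> 0" using c0 s(2) by auto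
    have "\<exists>d y. y \<in> S' \<and> v = (\<lambda>x. y x + d * s x)" if v: "v \<in> S" for v
    proof -
      obtain c w where c: "w \<in> span_of I e" "v = (\<lambda>x. c * e i x + w x)"
        using decomp[OF v] by blast
      define y where "y = (\<lambda>x. v x + (- c / c0) * s x)"
      have y: "y = (\<lambda>x. 1 * w x + (- c / c0) * w0 x)"
        using \<open>c0 \<noteq> 0\<close> by (auto simp: y_def c c0 field_simps)
      have "y \<in> span_of I e" unfolding y by (rule span_of_combination[OF c(1) c0(1)])
      moreover have "y \<in> S" unfolding y_def by (rule add_scaled_mem[OF v s(1)])
      ultimately have "y \<in> S'" by (simp add: S'_def)
      moreover have "v = (\<lambda>x. y x + (c / c0) * s x)" by (auto simp: y_def)
      ultimately show ?thesis by blast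
    qed
    then have "\<forall>k. \<exists>d y. y \<in> S' \<and> X k = (\<lambda>x. y x + d * s x)"
      using insert.prems(3) by blast
    then obtain d Y where Y: "\<And>k. Y k \<in> S'" "\<And>k. X k = (\<lambda>x. Y k x + d k * s x)"
      by metis
    note X_mem = insert.prems(3) and X_Cauchy = insert.prems(4)
    show ?thesis
    proof (cases "\<exists>\<delta>>0. \<forall>y\<in>S'. \<delta> \<le> p (\<lambda>x. s x + y x)")
      case True
      then obtain \<delta> where \<delta>: "\<delta> > 0" "\<And>y. y \<in> S' \<Longrightarrow> \<delta> \<le> p (\<lambda>x. s x + y x)" by blast
      have d_le: "\<bar>d m - d n\<bar> \<le> p (\<lambda>x. X m x - X n x) / \<delta>" for m n
      proof (cases "d m = d n")
        case False
        \<comment> \<open>Divided by \<open>D\<close>, the difference \<open>X m - X n\<close> has the form \<open>s + y\<close> with \<open>y \<in> S'\<close>.\<close>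
        define D where "D = d m - d n"
        have D: "D \<noteq> 0" using False by (simp add: D_def)
        have "\<delta> \<le> p (\<lambda>x. s x + (1 / D) * (Y m x - Y n x))"
          using Y(1) by (intro \<delta>(2) S'.scale_mem S'.diff_mem)
        also have "(\<lambda>x. s x + (1 / D) * (Y m x - Y n x)) = (\<lambda>x. (1 / D) * (X m x - X n x))"
          using D by (auto simp: Y(2) D_def field_simps)
        also have "p \<dots> \<le> \<bar>1 / D\<bar> * p (\<lambda>x. X m x - X n x)"
          by (intro scale_le diff_mem X_mem)
        finally show ?thesis using D \<delta>(1) by (simp add: D_def field_simps)
      qed (use \<delta>(1) nonneg[OF diff_mem[OF X_mem X_mem]] in simp)
      have "Cauchy d"
        unfolding Cauchy_def
      proof (intro allI impI)
        fix \<epsilon> :: real assume "\<epsilon> > 0"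
        then obtain N where N: "\<And>m n. m \<ge> N \<Longrightarrow> n \<ge> N \<Longrightarrow> p (\<lambda>x. X m x - X n x) < \<epsilon> * \<delta>"
          using X_Cauchy \<delta>(1) by (meson mult_pos_pos)
        have "dist (d m) (d n) < \<epsilon>" if "m \<ge> N" "n \<ge> N" for m n
          using d_le[of m n] N[OF that] \<delta>(1)
          by (smt (verit) dist_real_def divide_less_eq)
        then show "\<exists>M. \<forall>m\<ge>M. \<forall>n\<ge>M. dist (d m) (d n) < \<epsilon>" by blast
      qed
      then obtain d' where d': "d \<longlonglongrightarrow> d'" using Cauchy_convergent_iff convergent_def by blast
      have Y_le: "p (\<lambda>x. Y m x - Y n x) \<le> (1 + p s / \<delta>) * p (\<lambda>x. X m x - X n x)" for m n
      proof -
        have "(\<lambda>x. Y m x - Y n x) = (\<lambda>x. (X m x - X n x) + (d n - d m) * s x)"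
          by (auto simp: Y(2) algebra_simps)
        then have "p (\<lambda>x. Y m x - Y n x) \<le> p (\<lambda>x. X m x - X n x) + \<bar>d n - d m\<bar> * p s"
          using add_scaled_le[OF diff_mem[OF X_mem X_mem] s(1), of m n "d n - d m"] by simp
        also have "\<dots> \<le> p (\<lambda>x. X m x - X n x) + p (\<lambda>x. X m x - X n x) / \<delta> * p s"
          using d_le[of m n] nonneg[OF s(1)]
          by (intro add_left_mono mult_right_mono) (auto simp: abs_minus_commute)
        finally show ?thesis by (simp add: algebra_simps)
      qed
      have "\<forall>\<epsilon>>0. \<exists>N. \<forall>m\<ge>N. \<forall>n\<ge>N. p (\<lambda>x. Y m x - Y n x) < \<epsilon>"
      proof (intro allI impI)
        fix \<epsilon> :: real assume "\<epsilon> > 0"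
        define K where "K = 1 + p s / \<delta>"
        have K: "K > 0" using nonneg[OF s(1)] \<delta>(1) by (simp add: K_def add_pos_nonneg)
        obtain N where N: "\<And>m n. m \<ge> N \<Longrightarrow> n \<ge> N \<Longrightarrow> p (\<lambda>x. X m x - X n x) < \<epsilon> / K"
          using X_Cauchy K \<open>\<epsilon> > 0\<close> by (meson divide_pos_pos)
        have "p (\<lambda>x. Y m x - Y n x) < \<epsilon>" if "m \<ge> N" "n \<ge> N" for m n
          using Y_le[of m n, folded K_def] N[OF that] K by (simp add: field_simps)
        then show "\<exists>N. \<forall>m\<ge>N. \<forall>n\<ge>N. p (\<lambda>x. Y m x - Y n x) < \<epsilon>" by blast
      qed
      from IH[OF Y(1) this]
      obtain y where y: "y \<in> S'" "(\<lambda>k. p (\<lambda>x. Y k x - y x)) \<longlonglongrightarrow> 0"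
        by (rule bexE)
      define z where "z = (\<lambda>x. y x + d' * s x)"
      have z: "z \<in> S" unfolding z_def by (intro add_scaled_mem S'S[OF y(1)] s(1))
      have "(\<lambda>k. p (\<lambda>x. X k x - z x)) \<longlonglongrightarrow> 0"
      proof (rule tendsto_sandwich[OF _ _ tendsto_const])
        show "\<forall>\<^sub>F k in sequentially. 0 \<le> p (\<lambda>x. X k x - z x)"
          by (intro always_eventually allI nonneg diff_mem X_mem z)
        show "\<forall>\<^sub>F k in sequentially. p (\<lambda>x. X k x - z x) \<le> p (\<lambda>x. Y k x - y x) + \<bar>d k - d'\<bar> * p s"
        proof (intro always_eventually allI)
          fix k
          have "(\<lambda>x. X k x - z x) = (\<lambda>x. (Y k x - y x) + (d k - d') * s x)"
            by (auto simp: Y(2) z_def algebra_simps)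
          then show "p (\<lambda>x. X k x - z x) \<le> p (\<lambda>x. Y k x - y x) + \<bar>d k - d'\<bar> * p s"
            using add_scaled_le[OF diff_mem[OF S'S[OF Y(1)] S'S[OF y(1)]] s(1), of k "d k - d'"] by simp
        qed
        have "(\<lambda>k. p (\<lambda>x. Y k x - y x) + \<bar>d k - d'\<bar> * p s) \<longlonglongrightarrow> 0 + \<bar>d' - d'\<bar> * p s"
          by (intro tendsto_intros y(2) d')
        then show "(\<lambda>k. p (\<lambda>x. Y k x - y x) + \<bar>d k - d'\<bar> * p s) \<longlonglongrightarrow> 0" by simp
      qed
      then show ?thesis using z by blast
    next
      case False
      then have "\<forall>n. \<exists>y\<in>S'. p (\<lambda>x. s x + y x) < inverse (real (Suc n))"
        by (metis not_le inverse_positive_iff_positive of_nat_0_less_iff zero_less_Suc)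
      then obtain q where q: "\<And>n. q n \<in> S'" "\<And>n. p (\<lambda>x. s x + q n x) < inverse (real (Suc n))"
        by metis
      have "\<forall>\<epsilon>>0. \<exists>N. \<forall>m\<ge>N. \<forall>n\<ge>N. p (\<lambda>x. q m x - q n x) < \<epsilon>"
      proof (intro allI impI)
        fix \<epsilon> :: real assume "\<epsilon> > 0"
        then obtain N where N: "inverse (real (Suc N)) < \<epsilon> / 2"
          using reals_Archimedean[of "\<epsilon> / 2"] by auto
        have "p (\<lambda>x. q m x - q n x) < \<epsilon>" if mn: "m \<ge> N" "n \<ge> N" for m n
        proof -
          have mem: "(\<lambda>x. s x + q k x) \<in> S" for k by (intro add_mem s(1) S'S q(1))
          have "p (\<lambda>x. q m x - q n x) \<le> p (\<lambda>x. s x + q m x) + p (\<lambda>x. s x + q n x)"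
            using add_scaled_le[OF mem mem, of m "-1" n] by simp
          also have "\<dots> < inverse (real (Suc m)) + inverse (real (Suc n))"
            by (intro add_strict_mono q(2))
          also have "\<dots> \<le> inverse (real (Suc N)) + inverse (real (Suc N))"
            using mn by (intro add_mono le_imp_inverse_le) auto
          finally show ?thesis using N by simp
        qed
        then show "\<exists>N. \<forall>m\<ge>N. \<forall>n\<ge>N. p (\<lambda>x. q m x - q n x) < \<epsilon>" by blast
      qed
      from IH[OF q(1) this]
      obtain y where y: "y \<in> S'" "(\<lambda>k. p (\<lambda>x. q k x - y x)) \<longlonglongrightarrow> 0"
        by (rule bexE)
      have sy: "(\<lambda>x. s x + y x) \<in> S" by (intro add_mem s(1) S'S y(1))
      have "p (\<lambda>x. s x + y x) \<le> 0"
      proof (rule LIMSEQ_le_const)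
        have "(\<lambda>k. inverse (real (Suc k)) + p (\<lambda>x. q k x - y x)) \<longlonglongrightarrow> 0 + 0"
          by (intro tendsto_add LIMSEQ_inverse_real_of_nat y(2))
        then show "(\<lambda>k. inverse (real (Suc k)) + p (\<lambda>x. q k x - y x)) \<longlonglongrightarrow> 0" by simp
        have "p (\<lambda>x. s x + y x) \<le> inverse (real (Suc k)) + p (\<lambda>x. q k x - y x)" for k
          using add_scaled_le[OF add_mem[OF s(1) S'S[OF q(1)]] diff_mem[OF S'S[OF q(1)] S'S[OF y(1)]], of k "-1" k]
            q(2)[of k] by (simp add: algebra_simps)
        then show "\<exists>N. \<forall>k\<ge>N. p (\<lambda>x. s x + y x) \<le> inverse (real (Suc k)) + p (\<lambda>x. q k x - y x)"
          by blast
      qed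
      then have p0: "p (\<lambda>x. s x + y x) = 0" using nonneg[OF sy] by simp
      \<comment> \<open>The limit \<open>y\<close> satisfies \<open>p (s + y) = 0\<close>, so \<open>s\<close> is replaced by \<open>- y\<close>.\<close>
      define Z where "Z = (\<lambda>k x. Y k x + (- d k) * y x)"
      have Z: "Z k \<in> S'" for k unfolding Z_def by (intro S'.add_scaled_mem Y(1) y(1))
      have Z_le: "p (\<lambda>x. Z m x - Z n x) \<le> p (\<lambda>x. X m x - X n x)" for m n
      proof -
        have "(\<lambda>x. Z m x - Z n x) = (\<lambda>x. (X m x - X n x) + (d n - d m) * (s x + y x))"
          by (auto simp: Y(2) Z_def algebra_simps)
        then show ?thesis
          using add_scaled_le[OF diff_mem[OF X_mem X_mem] sy, of m n "d n - d m"] p0 by simp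
      qed
      have "\<forall>\<epsilon>>0. \<exists>N. \<forall>m\<ge>N. \<forall>n\<ge>N. p (\<lambda>x. Z m x - Z n x) < \<epsilon>"
        using X_Cauchy Z_le by (meson le_less_trans)
      from IH[OF Z this]
      obtain z where z: "z \<in> S'" "(\<lambda>k. p (\<lambda>x. Z k x - z x)) \<longlonglongrightarrow> 0"
        by (rule bexE)
      have "(\<lambda>k. p (\<lambda>x. X k x - z x)) \<longlonglongrightarrow> 0"
      proof (rule tendsto_sandwich[OF _ _ tendsto_const z(2)])
        show "\<forall>\<^sub>F k in sequentially. 0 \<le> p (\<lambda>x. X k x - z x)"
          by (intro always_eventually allI nonneg diff_mem X_mem S'S[OF z(1)])
        show "\<forall>\<^sub>F k in sequentially. p (\<lambda>x. X k x - z x) \<le> p (\<lambda>x. Z k x - z x)"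
        proof (intro always_eventually allI)
          fix k
          have "(\<lambda>x. X k x - z x) = (\<lambda>x. (Z k x - z x) + d k * (s x + y x))"
            by (auto simp: Y(2) Z_def algebra_simps)
          then show "p (\<lambda>x. X k x - z x) \<le> p (\<lambda>x. Z k x - z x)"
            using add_scaled_le[OF diff_mem[OF S'S[OF Z] S'S[OF z(1)]] sy, of k "d k"] p0 by simp
        qed
      qed
      then show ?thesis using S'S[OF z(1)] by blast
    qed
  qed
qed

text \<open>fixed point\<close>

text \<open>Banach's iteration from the centre of the ball.  Since \<open>F^n\<close> contracts by \<open>2^-n\<close> and every iterate stays
  within \<open>\<rho>\<close> of the centre, the \<open>n\<close>-th iterate is within \<open>\<rho> 2^-n\<close> of all later ones.  With a seminorm, the
  limit is determined, and fixed, only up to distance 0.\<close>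
theorem contraction_approximate_fixed_point:
  fixes p :: "('a \<Rightarrow> real) \<Rightarrow> real" and S :: "('a \<Rightarrow> real) set"
    and F :: "('a \<Rightarrow> real) \<Rightarrow> 'a \<Rightarrow> real" and c :: "'a \<Rightarrow> real" and \<rho> :: real
  defines "D \<equiv> {v. (\<lambda>x. v x - c x) \<in> S \<and> p (\<lambda>x. v x - c x) \<le> \<rho>}"
  assumes fin: "finite I" "S \<subseteq> span_of I e" and S: "seminormed_function_space S p"
    and \<rho>: "0 \<le> \<rho>"
    and maps: "\<And>v. v \<in> D \<Longrightarrow> F v \<in> D"
    and contr: "\<And>v w. v \<in> D \<Longrightarrow> w \<in> D \<Longrightarrow> p (\<lambda>x. F v x - F w x) \<le> 1 / 2 * p (\<lambda>x. v x - w x)"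
  shows "\<exists>z\<in>D. p (\<lambda>x. F z x - z x) = 0"
proof -
  interpret seminormed_function_space S p by fact
  have diffD: "(\<lambda>x. v x - w x) \<in> S" if "v \<in> D" "w \<in> D" for v w
    using diff_mem[of "\<lambda>x. v x - c x" "\<lambda>x. w x - c x"] that by (simp add: D_def)
  have tri: "p (\<lambda>x. u x - w x) \<le> p (\<lambda>x. u x - v x) + p (\<lambda>x. v x - w x)"
    if "u \<in> D" "v \<in> D" "w \<in> D" for u v w
    using triangle[of "\<lambda>x. u x - c x" "\<lambda>x. v x - c x" "\<lambda>x. w x - c x"] that by (simp add: D_def)
  have comm: "p (\<lambda>x. v x - w x) \<le> p (\<lambda>x. w x - v x)" if "v \<in> D" "w \<in> D" for v w
    using diff_commute_le[of "\<lambda>x. v x - c x" "\<lambda>x. w x - c x"] that by (simp add: D_def)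
  define X where "X k = (F ^^ k) c" for k
  have cD: "c \<in> D" using \<rho> by (simp add: D_def zero zero_mem)
  have X: "X k \<in> D" for k
    by (induction k) (auto simp: X_def cD maps)
  have XSuc: "X (Suc k) = F (X k)" for k by (simp add: X_def)
  have geo: "p (\<lambda>x. X (n + j) x - X n x) \<le> \<rho> * (1 / 2) ^ n" for n j
  proof (induction n)
    case 0
    show ?case using X[of j] by (simp add: X_def D_def)
  next
    case (Suc n)
    then show ?case
      using contr[OF X[of "n + j"] X[of n]] by (simp add: XSuc)
  qed
  have "\<forall>\<epsilon>>0. \<exists>N. \<forall>m\<ge>N. \<forall>n\<ge>N. p (\<lambda>x. (X m x - c x) - (X n x - c x)) < \<epsilon>"
  proof (intro allI impI)
    fix \<epsilon> :: real assume "\<epsilon> > 0"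
    have "(\<lambda>n. \<rho> * (1 / 2) ^ n) \<longlonglongrightarrow> \<rho> * 0"
      by (intro tendsto_intros LIMSEQ_realpow_zero) auto
    then have "\<forall>\<^sub>F n in sequentially. \<rho> * (1 / 2) ^ n < \<epsilon> / 2"
      using \<open>\<epsilon> > 0\<close> by (intro order_tendstoD(2)) auto
    then obtain N where N: "\<rho> * (1 / 2) ^ N < \<epsilon> / 2"
      by (auto simp: eventually_sequentially)
    have "p (\<lambda>x. X m x - X n x) < \<epsilon>" if "m \<ge> N" "n \<ge> N" for m n
    proof -
      have "p (\<lambda>x. X m x - X N x) \<le> \<rho> * (1 / 2) ^ N" "p (\<lambda>x. X n x - X N x) \<le> \<rho> * (1 / 2) ^ N"
        using geo[of N "m - N"] geo[of N "n - N"] that by simp_all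
      then show ?thesis
        using tri[OF X X X, of m n N] comm[OF X X, of N n] N by linarith
    qed
    then show "\<exists>N. \<forall>m\<ge>N. \<forall>n\<ge>N. p (\<lambda>x. (X m x - c x) - (X n x - c x)) < \<epsilon>" by auto
  qed
  moreover have "(\<lambda>x. X k x - c x) \<in> S" for k using X[of k] by (simp add: D_def)
  ultimately obtain y where y: "y \<in> S" "(\<lambda>k. p (\<lambda>x. (X k x - c x) - y x)) \<longlonglongrightarrow> 0"
    using finite_dimensional_complete[OF fin(1) S fin(2), of "\<lambda>k x. X k x - c x"] by blast
  define z where "z = (\<lambda>x. c x + y x)"
  have lim: "(\<lambda>k. p (\<lambda>x. X k x - z x)) \<longlonglongrightarrow> 0"
    using y(2) by (simp add: z_def algebra_simps)
  have "p y \<le> \<rho>"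
  proof (rule LIMSEQ_le_const)
    show "(\<lambda>k. \<rho> + p (\<lambda>x. X k x - z x)) \<longlonglongrightarrow> \<rho>"
      using tendsto_add[OF tendsto_const lim, of \<rho>] by simp
    have "p y \<le> \<rho> + p (\<lambda>x. X k x - z x)" for k
    proof -
      have XS: "(\<lambda>x. X k x - c x) \<in> S" "p (\<lambda>x. X k x - c x) \<le> \<rho>" using X[of k] by (simp_all add: D_def)
      have "p y \<le> p (\<lambda>x. X k x - c x) + \<bar>-1\<bar> * p (\<lambda>x. (X k x - c x) - y x)"
        using add_scaled_le[OF XS(1) diff_mem[OF XS(1) y(1)], of "-1"] by simp
      then show ?thesis using XS(2) by (simp add: z_def algebra_simps)
    qed
    then show "\<exists>N. \<forall>k\<ge>N. p y \<le> \<rho> + p (\<lambda>x. X k x - z x)" by blast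
  qed
  then have z: "z \<in> D" using y(1) by (simp add: D_def z_def)
  have "p (\<lambda>x. F z x - z x) \<le> 0"
  proof (rule LIMSEQ_le_const)
    have "(\<lambda>k. 1 / 2 * p (\<lambda>x. X k x - z x) + p (\<lambda>x. X (Suc k) x - z x)) \<longlonglongrightarrow> 1 / 2 * 0 + 0"
      by (intro tendsto_add tendsto_mult tendsto_const lim LIMSEQ_Suc[OF lim])
    then show "(\<lambda>k. 1 / 2 * p (\<lambda>x. X k x - z x) + p (\<lambda>x. X (Suc k) x - z x)) \<longlonglongrightarrow> 0" by simp
    have "p (\<lambda>x. F z x - z x) \<le> 1 / 2 * p (\<lambda>x. X k x - z x) + p (\<lambda>x. X (Suc k) x - z x)" for k
      using tri[OF maps[OF z] X z, of "Suc k"] contr[OF z X, of k] comm[OF z X, of k]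
      by (simp add: XSuc)
    then show "\<exists>N. \<forall>k\<ge>N. p (\<lambda>x. F z x - z x)
        \<le> 1 / 2 * p (\<lambda>x. X k x - z x) + p (\<lambda>x. X (Suc k) x - z x)" by blast
  qed
  then show ?thesis
    using z nonneg[OF diffD[OF maps[OF z] z]] by (intro bexI[of _ z]) auto
qed

section \<open>The discrete problem\<close>

lemma L2_on_linear:
  assumes "L2_on \<Omega> v" "L2_on \<Omega> w"
  shows "L2_on \<Omega> (\<lambda>x. a * v x + b * w x)"
  unfolding L2_on_def
proof
  show m: "(\<lambda>x. a * v x + b * w x) \<in> borel_measurable (lebesgue_on \<Omega>)"
    using assms unfolding L2_on_def by (intro borel_measurable_add borel_measurable_times) auto
  show "integrable (lebesgue_on \<Omega>) (\<lambda>x. (a * v x + b * w x)\<^sup>2)"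
  proof (rule Bochner_Integration.integrable_bound)
    show "integrable (lebesgue_on \<Omega>) (\<lambda>x. 2 * a\<^sup>2 * (v x)\<^sup>2 + 2 * b\<^sup>2 * (w x)\<^sup>2)"
      using assms unfolding L2_on_def by auto
    show "(\<lambda>x. (a * v x + b * w x)\<^sup>2) \<in> borel_measurable (lebesgue_on \<Omega>)"
      using m by (rule borel_measurable_power)
    show "AE x in lebesgue_on \<Omega>. norm ((a * v x + b * w x)\<^sup>2)
        \<le> norm (2 * a\<^sup>2 * (v x)\<^sup>2 + 2 * b\<^sup>2 * (w x)\<^sup>2)"
    proof (rule AE_I2)
      fix x
      have "0 \<le> (a * v x - b * w x)\<^sup>2" by simp
      then have "(a * v x + b * w x)\<^sup>2 \<le> 2 * a\<^sup>2 * (v x)\<^sup>2 + 2 * b\<^sup>2 * (w x)\<^sup>2"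
        by (simp add: power2_eq_square algebra_simps)
      then show "norm ((a * v x + b * w x)\<^sup>2) \<le> norm (2 * a\<^sup>2 * (v x)\<^sup>2 + 2 * b\<^sup>2 * (w x)\<^sup>2)"
        by simp
    qed
  qed
qed

lemma Hsp_2_iff: "v \<in> Hsp \<Omega> 2 \<longleftrightarrow> (\<forall>\<alpha>. mi_order \<alpha> \<le> 2 \<longrightarrow> (\<exists>w. is_weak_deriv \<Omega> \<alpha> v w \<and> L2_on \<Omega> w))"
  by (simp add: Hsp_def frac_def)

lemma H2_seminormed:
  fixes \<Omega> :: "(real^'n::finite) set"
  assumes "open \<Omega>"
  shows "seminormed_function_space (Hsp \<Omega> 2) (Hnorm \<Omega> 2)"
proof
  show "(\<lambda>x. 0) \<in> Hsp \<Omega> 2"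
    unfolding Hsp_2_iff
    by (intro allI impI exI[of _ "\<lambda>x. 0"])
       (simp add: is_weak_deriv_def L2_on_def locally_integrable_def inner_L2_def)
  show "(\<lambda>x. a * v x + b * w x) \<in> Hsp \<Omega> 2" if vw: "v \<in> Hsp \<Omega> 2" "w \<in> Hsp \<Omega> 2" for v w a b
    unfolding Hsp_2_iff
  proof (intro allI impI)
    fix \<alpha> :: "'n \<Rightarrow> nat" assume "mi_order \<alpha> \<le> 2"
    then obtain v' w' where "is_weak_deriv \<Omega> \<alpha> v v'" "L2_on \<Omega> v'" "is_weak_deriv \<Omega> \<alpha> w w'" "L2_on \<Omega> w'"
      using vw unfolding Hsp_2_iff by meson
    then show "\<exists>z. is_weak_deriv \<Omega> \<alpha> (\<lambda>x. a * v x + b * w x) z \<and> L2_on \<Omega> z"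
      by (intro exI[of _ "\<lambda>x. a * v' x + b * w' x"] conjI weak_deriv_linear[OF assms] L2_on_linear)
  qed
qed (use Hnorm_nonneg Hnorm_2_combination_le[OF assms] in auto)

lemma Hsp_nat_mono:
  assumes "v \<in> Hsp \<Omega> s" "real m \<le> s"
  shows "v \<in> Hsp \<Omega> (real m)"
proof -
  have "m \<le> nat \<lfloor>s\<rfloor>" using assms(2) by (simp add: le_nat_floor)
  then show ?thesis using assms(1) by (simp add: Hsp_def)
qed

text \<open>Finite elements come with a set of basis functions, Legendre spaces with a set of multi-indices; this brings
  both to a common index type.\<close>
lemma span_of_nat_indexed:
  assumes "finite I"
  shows "\<exists>(n::nat) e'. span_of I e = span_of {0..<n} e'"
proof -
  obtain f where f: "bij_betw f {0..<card I} I"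
    using ex_bij_betw_nat_finite[OF assms] by blast
  have "span_of I e = span_of {0..<card I} (\<lambda>j. e (f j))"
  proof (intro equalityI subsetI)
    fix v assume "v \<in> span_of I e"
    then obtain c where "v = (\<lambda>x. \<Sum>i\<in>I. c i * e i x)" by (auto simp: span_of_def)
    then have "v = (\<lambda>x. \<Sum>j\<in>{0..<card I}. c (f j) * e (f j) x)"
      by (simp add: sum.reindex_bij_betw[OF f, symmetric])
    then show "v \<in> span_of {0..<card I} (\<lambda>j. e (f j))" by (rule span_ofI)
  next
    fix v assume "v \<in> span_of {0..<card I} (\<lambda>j. e (f j))"
    then obtain c where v: "v = (\<lambda>x. \<Sum>j\<in>{0..<card I}. c j * e (f j) x)" by (auto simp: span_of_def)
    define c' where "c' = (\<lambda>i. c (the_inv_into {0..<card I} f i))"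
    have "c' (f j) = c j" if "j \<in> {0..<card I}" for j
      using f that by (simp add: c'_def the_inv_into_f_f bij_betw_def)
    then have "v = (\<lambda>x. \<Sum>i\<in>I. c' i * e i x)"
      by (simp add: v sum.reindex_bij_betw[OF f, symmetric])
    then show "v \<in> span_of I e" by (rule span_ofI)
  qed
  then show ?thesis by blast
qed

lemma legendre_space_eq_span:
  fixes a b :: "real^'n::finite"
  shows "\<exists>e. legendre_space a b N = span_of {\<alpha> :: 'n \<Rightarrow> nat. \<forall>i. \<alpha> i \<le> N} e"
proof
  let ?P = "\<lambda>\<alpha> x. \<Prod>i\<in>UNIV. legendre (\<alpha> i) ((2 * x $ i - a $ i - b $ i) / (b $ i - a $ i))"
  let ?e = "\<lambda>\<alpha> x. if x \<in> cbox a b then ?P \<alpha> x else 0"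
  have "(\<lambda>x. if x \<in> cbox a b then \<Sum>\<alpha> | \<forall>i. \<alpha> i \<le> N. c \<alpha> * ?P \<alpha> x else 0)
      = (\<lambda>x. \<Sum>\<alpha> | \<forall>i. \<alpha> i \<le> N. c \<alpha> * ?e \<alpha> x)" for c
    by (intro ext) simp
  then show "legendre_space a b N = span_of {\<alpha>. \<forall>i. \<alpha> i \<le> N} ?e"
    unfolding legendre_space_def span_of_def by (simp only:)
qed

lemma discrete_spaces_finite_dimensional:
  fixes \<Omega> :: "(real^'n::finite) set"
  assumes "fem_spaces \<Omega> H r Vh \<or> spectral_spaces \<Omega> H r Vh" "h \<in> H"
  shows "h > 0" "Vh h \<subseteq> Hsp \<Omega> 2" "\<exists>(n::nat) e. Vh h = span_of {0..<n} e"
proof -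
  have "h > 0 \<and> Vh h \<subseteq> Hsp \<Omega> 2 \<and> (\<exists>(n::nat) e. Vh h = span_of {0..<n} e)"
    using assms(1)
  proof
    assume A: "fem_spaces \<Omega> H r Vh"
    then have *: "h > 0" "Vh h \<subseteq> Hsp \<Omega> 2" "fin_dim_space (Vh h)"
      using assms(2) unfolding fem_spaces_def by auto
    then obtain B where B: "finite B" "Vh h = span_of B (\<lambda>b. b)"
      unfolding fin_dim_space_def span_of_def by (elim exE conjE)
    have "\<exists>(n::nat) e. Vh h = span_of {0..<n} e"
      unfolding B(2) by (rule span_of_nat_indexed[OF B(1)])
    then show ?thesis using * by (intro conjI)
  next
    assume A: "spectral_spaces \<Omega> H r Vh"
    then obtain a b where ab: "H = {1 / real N | N. N \<ge> 2}"
        "\<forall>N\<ge>2. r (1 / real N) = N \<and> Vh (1 / real N) = legendre_space a b N"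
      unfolding spectral_spaces_def by (elim exE conjE)
    obtain N where N: "N \<ge> 2" "h = 1 / real N" using ab(1) assms(2) by blast
    have "Vh h = legendre_space a b N" using ab(2) N by simp
    moreover obtain e where "legendre_space a b N = span_of {\<alpha> :: 'n \<Rightarrow> nat. \<forall>i. \<alpha> i \<le> N} e"
      using legendre_space_eq_span[of a b N] by (elim exE)
    ultimately have e: "Vh h = span_of {\<alpha> :: 'n \<Rightarrow> nat. \<forall>i. \<alpha> i \<le> N} e" by simp
    have "finite {\<alpha> :: 'n \<Rightarrow> nat. \<forall>i. \<alpha> i \<le> N}"
    proof (rule finite_subset)
      show "{\<alpha> :: 'n \<Rightarrow> nat. \<forall>i. \<alpha> i \<le> N} \<subseteq> UNIV \<rightarrow>\<^sub>E {..N}" by (auto intro: PiE_I)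
      show "finite ((UNIV :: 'n set) \<rightarrow>\<^sub>E {..N})" by (intro finite_PiE) auto
    qed
    then have "\<exists>(n::nat) e. Vh h = span_of {0..<n} e"
      unfolding e by (rule span_of_nat_indexed)
    moreover have "Vh h \<subseteq> Hsp \<Omega> 2" using A assms(2) unfolding spectral_spaces_def by simp
    ultimately show ?thesis using N by simp
  qed
  then show "h > 0" "Vh h \<subseteq> Hsp \<Omega> 2" "\<exists>(n::nat) e. Vh h = span_of {0..<n} e" by simp_all
qed

text \<open>In the spectral method the degree is \<open>1/h\<close>, so that \<open>\<ell> = min (1/h + 1) s\<close> may grow as \<open>h\<close> decreases; it
  reaches \<open>s\<close> at \<open>h = 1/s\<close> at the latest.  For finite elements the degree is at least 5.\<close>
lemma ell_eventually_constant:
  fixes \<Omega> :: "(real^'n::finite) set"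
  assumes "fem_spaces \<Omega> H r Vh \<or> spectral_spaces \<Omega> H r Vh" "s \<ge> 3"
  shows "\<exists>L \<eta>. L \<ge> 3 \<and> \<eta> > 0 \<and> (\<forall>h\<in>H. h \<le> \<eta> \<longrightarrow> ell r s h = L)"
  using assms(1)
proof
  assume "fem_spaces \<Omega> H r Vh"
  then have "\<exists>k\<ge>5. \<forall>h\<in>H. r h = k" unfolding fem_spaces_def by (elim conjE)
  then obtain k where k: "k \<ge> 5" "\<forall>h\<in>H. r h = k" by (elim exE conjE)
  show ?thesis
    by (rule exI[of _ "min (real k + 1) s"], rule exI[of _ 1])
       (use k assms(2) in \<open>auto simp: ell_def\<close>)
next
  assume "spectral_spaces \<Omega> H r Vh"
  then obtain a b where H: "H = {1 / real N | N. N \<ge> 2}"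
      "\<forall>N\<ge>2. r (1 / real N) = N \<and> Vh (1 / real N) = legendre_space a b N"
    unfolding spectral_spaces_def by (elim exE conjE)
  have "ell r s h = s" if h: "h \<in> H" "h \<le> 1 / s" for h
  proof -
    obtain N where N: "N \<ge> 2" "h = 1 / real N" using H(1) h(1) by blast
    then have "s \<le> real N" using h(2) assms(2) unfolding N(2) by (simp add: field_simps)
    then show ?thesis using H(2) N by (simp add: ell_def)
  qed
  then show ?thesis
    by (intro exI[of _ s] exI[of _ "1 / s"]) (use assms(2) in simp)
qed

text \<open>The contraction argument for one mesh.  The differences of functions with the prescribed boundary values
  form the finite-dimensional space of discrete functions with zero boundary values, where the contraction
  theorem applies.  Fixed points up to seminorm zero are turned into genuine ones by \<open>lin_form_0_if_Hnorm_2_0\<close>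
  and the uniqueness part of the well-posedness of \<open>T\<close>.\<close>
theorem galerkin_solution_unique_in_ball:
  fixes \<Omega> :: "(real^'n::finite) set" and I :: "'i set"
  assumes \<Omega>: "open \<Omega>" and V: "finite I" "V = span_of I e" "V \<subseteq> Hsp \<Omega> 2"
    and c: "c \<in> Vh_bc \<Omega> V g" and \<rho>: "0 \<le> \<rho>"
    and well_defined: "\<And>w. w \<in> Vh_bc \<Omega> V g \<Longrightarrow> \<exists>!z. T_equation \<Omega> V f g \<epsilon> u w z"
    and start: "Hnorm \<Omega> 2 (\<lambda>x. c x - T_map \<Omega> V f g \<epsilon> u c x) \<le> \<rho> / 2"
    and contraction: "\<And>v w. v \<in> Bh \<Omega> V g c \<rho> \<Longrightarrow> w \<in> Bh \<Omega> V g c \<rho> \<Longrightarrow>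
      Hnorm \<Omega> 2 (\<lambda>x. T_map \<Omega> V f g \<epsilon> u v x - T_map \<Omega> V f g \<epsilon> u w x) \<le> 1 / 2 * Hnorm \<Omega> 2 (\<lambda>x. v x - w x)"
  shows "\<exists>!uh. uh \<in> Bh \<Omega> V g c \<rho> \<and> galerkin_solution \<Omega> V f g \<epsilon> uh"
proof -
  let ?T = "T_map \<Omega> V f g \<epsilon> u" and ?S = "Vh_zero \<Omega> V" and ?p = "Hnorm \<Omega> 2"
  interpret H2: seminormed_function_space "Hsp \<Omega> 2" ?p by (rule H2_seminormed[OF \<Omega>])
  have V_comb: "(\<lambda>x. a * v x + b * w x) \<in> V" if "v \<in> V" "w \<in> V" for v w a b
    using span_of_combination that unfolding V(2) by blast
  interpret seminormed_function_space ?S ?p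
  proof (rule H2.subspaceI)
    show "?S \<subseteq> Hsp \<Omega> 2" using V(3) by (auto simp: Vh_bc_def)
    show "(\<lambda>x. 0) \<in> ?S" using zero_in_span_of V(2) by (auto simp: Vh_bc_def)
    show "(\<lambda>x. a * v x + b * w x) \<in> ?S" if "v \<in> ?S" "w \<in> ?S" for v w a b
      using V_comb that by (auto simp: Vh_bc_def)
  qed
  have affine: "(\<lambda>x. v x - c x) \<in> ?S \<longleftrightarrow> v \<in> Vh_bc \<Omega> V g" for v
  proof
    assume *: "(\<lambda>x. v x - c x) \<in> ?S"
    then have "(\<lambda>x. 1 * (v x - c x) + 1 * c x) \<in> V"
      using c by (intro V_comb) (auto simp: Vh_bc_def)
    then show "v \<in> Vh_bc \<Omega> V g" using * c by (auto simp: Vh_bc_def)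
  next
    assume "v \<in> Vh_bc \<Omega> V g"
    then show "(\<lambda>x. v x - c x) \<in> ?S"
      using c V_comb[of v c 1 "-1"] by (auto simp: Vh_bc_def)
  qed
  have ball: "Bh \<Omega> V g c \<rho> = {v. (\<lambda>x. v x - c x) \<in> ?S \<and> ?p (\<lambda>x. v x - c x) \<le> \<rho>}"
    unfolding Bh_def affine ..
  have diff: "(\<lambda>x. v x - w x) \<in> ?S" if "v \<in> Vh_bc \<Omega> V g" "w \<in> Vh_bc \<Omega> V g" for v w
    using that V_comb[of v w 1 "-1"] by (auto simp: Vh_bc_def)
  have lin0: "lin_form \<Omega> \<epsilon> u v \<psi> = 0" if "v \<in> ?S" "?p v = 0" for v \<psi>
    using that V(3) by (intro lin_form_0_if_Hnorm_2_0[OF \<Omega>]) (auto simp: Vh_bc_def)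
  have T_eq: "T_equation \<Omega> V f g \<epsilon> u w (?T w)" if "w \<in> Vh_bc \<Omega> V g" for w
    unfolding T_map_def using well_defined[OF that] by (rule theI')
  have T_mem: "?T w \<in> Vh_bc \<Omega> V g" if "w \<in> Vh_bc \<Omega> V g" for w
    using T_eq[OF that] by (simp add: T_equation_def)
  \<comment> \<open>At distance zero from \<open>w\<close>, the equation for \<open>T w\<close> loses its left-hand side and reads as the Galerkin equation for \<open>w\<close>.\<close>
  have T_eq_cong: "T_equation \<Omega> V f g \<epsilon> u w z \<longleftrightarrow> galerkin_solution \<Omega> V f g \<epsilon> w"
    if "w \<in> Vh_bc \<Omega> V g" "z \<in> Vh_bc \<Omega> V g" "?p (\<lambda>x. w x - z x) = 0" for w z
    using that lin0[OF diff[OF that(1,2)] that(3)]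
    unfolding T_equation_def galerkin_solution_def MA_identity_def
    by (auto simp: algebra_simps)
  have maps: "?T v \<in> Bh \<Omega> V g c \<rho>" if v: "v \<in> Bh \<Omega> V g c \<rho>" for v
  proof -
    have cB: "c \<in> Bh \<Omega> V g c \<rho>" using c \<rho> zero by (simp add: Bh_def)
    have mem: "v \<in> Vh_bc \<Omega> V g" "?p (\<lambda>x. v x - c x) \<le> \<rho>" using v by (simp_all add: Bh_def)
    have "?p (\<lambda>x. ?T v x - c x) = ?p (\<lambda>x. (?T v x - ?T c x) + (-1) * (c x - ?T c x))"
      by (intro arg_cong[where f = ?p]) auto
    also have "\<dots> \<le> ?p (\<lambda>x. ?T v x - ?T c x) + \<bar>-1\<bar> * ?p (\<lambda>x. c x - ?T c x)"
      by (intro add_scaled_le diff T_mem c mem)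
    also have "\<dots> \<le> \<rho>"
      using contraction[OF v cB] start mem(2) by simp
    finally show ?thesis using T_mem[OF mem(1)] by (simp add: Bh_def)
  qed
  show ?thesis
  proof (rule ex_ex1I)
    have "\<exists>z\<in>Bh \<Omega> V g c \<rho>. ?p (\<lambda>x. ?T z x - z x) = 0"
      unfolding ball
    proof (rule contraction_approximate_fixed_point[OF V(1) _ seminormed_function_space_axioms \<rho>])
      show "?S \<subseteq> span_of I e" by (auto simp: V(2)[symmetric] Vh_bc_def)
    qed (use maps contraction in \<open>simp_all only: flip: ball\<close>)
    then obtain z where z: "z \<in> Bh \<Omega> V g c \<rho>" "?p (\<lambda>x. ?T z x - z x) = 0" by blast
    have zV: "z \<in> Vh_bc \<Omega> V g" using z(1) by (simp add: Bh_def)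
    have "?p (\<lambda>x. z x - ?T z x) = 0"
      using z(2) nonneg[OF diff[OF zV T_mem[OF zV]]] scale_le[OF diff[OF T_mem[OF zV] zV], of "-1"] by simp
    then have "galerkin_solution \<Omega> V f g \<epsilon> z"
      using T_eq_cong[OF zV T_mem[OF zV]] T_eq[OF zV] by blast
    then show "\<exists>uh. uh \<in> Bh \<Omega> V g c \<rho> \<and> galerkin_solution \<Omega> V f g \<epsilon> uh" using z(1) by blast
  next
    fix v w
    assume v: "v \<in> Bh \<Omega> V g c \<rho> \<and> galerkin_solution \<Omega> V f g \<epsilon> v"
      and w: "w \<in> Bh \<Omega> V g c \<rho> \<and> galerkin_solution \<Omega> V f g \<epsilon> w"
    have mem: "v \<in> Vh_bc \<Omega> V g" "w \<in> Vh_bc \<Omega> V g" using v w by (simp_all add: Bh_def)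
    have fix_v: "T_equation \<Omega> V f g \<epsilon> u v v" and fix_w: "T_equation \<Omega> V f g \<epsilon> u w w"
      using v w T_eq_cong mem zero by simp_all
    have fixed: "?T v = v" "?T w = w"
      using fix_v fix_w T_eq mem well_defined by blast+
    have "?p (\<lambda>x. v x - w x) \<le> 1 / 2 * ?p (\<lambda>x. v x - w x)"
      using contraction[OF conjunct1[OF v] conjunct1[OF w]] unfolding fixed .
    then have "?p (\<lambda>x. v x - w x) = 0" using nonneg[OF diff[OF mem]] by simp
    then have "T_equation \<Omega> V f g \<epsilon> u v w" using T_eq_cong[OF mem] v by blast
    then show "v = w" using fix_v well_defined[OF mem(1)] by blast
  qed
qed

theorem theorem4p3:
  fixes \<Omega> :: "(real^'n::finite) set"
    and f g :: "real^'n \<Rightarrow> real"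
    and u :: "real \<Rightarrow> real^'n \<Rightarrow> real"
    and s :: real
    and H :: "real set"
    and r :: "real \<Rightarrow> nat"
    and Vh :: "real \<Rightarrow> (real^'n \<Rightarrow> real) set"
    and Ih :: "real \<Rightarrow> (real^'n \<Rightarrow> real) \<Rightarrow> real^'n \<Rightarrow> real"
    and C7 h0 \<rho>0 :: "real \<Rightarrow> real"
  defines "l \<equiv> ell r s"
    and "T \<equiv> \<lambda>\<epsilon> h. T_map \<Omega> (Vh h) f g \<epsilon> (u \<epsilon>)"
    and "B \<equiv> \<lambda>\<epsilon> h. Bh \<Omega> (Vh h) g (Ih h (u \<epsilon>))"
    and "\<rho>1 \<equiv> \<lambda>\<epsilon> h. 2 * C7 \<epsilon> * h powr (ell r s h - 2) * Hnorm \<Omega> (ell r s h) (u \<epsilon>)"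
  assumes dim: "CARD('n) \<in> {2, 3}"
    and domain: "convex_domain \<Omega>"
    and f: "L2_on \<Omega> f" "\<forall>x\<in>\<Omega>. f x > 0"
    and u: "\<forall>\<epsilon>>0. the_convex_solution \<Omega> f g \<epsilon> (u \<epsilon>)"
    and u_bounds: "a_priori_bounds \<Omega> u"
    and s: "s \<ge> 3" "\<forall>\<epsilon>>0. u \<epsilon> \<in> Hsp \<Omega> s"
    and spaces: "fem_spaces \<Omega> H r Vh \<or> spectral_spaces \<Omega> H r Vh"
    and interp: "interpolation_operator \<Omega> H r Vh s Ih"
      "\<forall>\<epsilon>>0. \<forall>h\<in>H. Ih h (u \<epsilon>) \<in> Vh_bc \<Omega> (Vh h) g"
    and T_well_defined: "\<forall>\<epsilon>>0. \<forall>h\<in>H. \<forall>w \<in> Vh_bc \<Omega> (Vh h) g.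
      \<exists>!z. T_equation \<Omega> (Vh h) f g \<epsilon> (u \<epsilon>) w z"
    and C7: "\<forall>\<epsilon>>0. C7 \<epsilon> > 0" "C7 \<in> O[at_right 0](\<lambda>\<epsilon>. 1 / \<epsilon> ^ CARD('n))"
      "\<forall>\<epsilon>>0. \<forall>h\<in>H. Hnorm \<Omega> 2 (\<lambda>x. Ih h (u \<epsilon>) x - T \<epsilon> h (Ih h (u \<epsilon>)) x)
         \<le> C7 \<epsilon> * h powr (l h - 2) * Hnorm \<Omega> (l h) (u \<epsilon>)"
    and h0: "\<forall>\<epsilon>>0. h0 \<epsilon> > 0 \<and> 0 < \<rho>0 \<epsilon> \<and> \<rho>0 \<epsilon> < 1 \<and>
      (\<forall>h\<in>H. h \<le> h0 \<epsilon> \<longrightarrow> (\<forall>v \<in> B \<epsilon> h (\<rho>0 \<epsilon>). \<forall>w \<in> B \<epsilon> h (\<rho>0 \<epsilon>).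
         Hnorm \<Omega> 2 (\<lambda>x. T \<epsilon> h v x - T \<epsilon> h w x) \<le> 1 / 2 * Hnorm \<Omega> 2 (\<lambda>x. v x - w x)))"
  shows "\<exists>C8. C8 \<in> O[at_right 0](\<lambda>\<epsilon>. 1 / \<epsilon> ^ CARD('n)) \<and>
    (\<forall>\<epsilon>>0. \<exists>h1>0. \<forall>h\<in>H. h \<le> min (h0 \<epsilon>) h1 \<longrightarrow>
       (\<exists>!uh. uh \<in> B \<epsilon> h (\<rho>1 \<epsilon> h) \<and> galerkin_solution \<Omega> (Vh h) f g \<epsilon> uh) \<and>
       (\<forall>uh. uh \<in> B \<epsilon> h (\<rho>1 \<epsilon> h) \<and> galerkin_solution \<Omega> (Vh h) f g \<epsilon> uh \<longrightarrow>
          Hnorm \<Omega> 2 (\<lambda>x. u \<epsilon> x - uh x) \<le> C8 \<epsilon> * h powr (l h - 2) * Hnorm \<Omega> (l h) (u \<epsilon>)))"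
proof -
  have \<Omega>: "open \<Omega>" using domain by (simp add: convex_domain_def)
  interpret H2: seminormed_function_space "Hsp \<Omega> 2" "Hnorm \<Omega> 2" by (rule H2_seminormed[OF \<Omega>])
  have C7_pos: "C7 \<epsilon> > 0" if "\<epsilon> > 0" for \<epsilon> using C7(1) that by blast
  \<comment> \<open>Either \<open>\<ell> = s\<close>, or \<open>\<ell> < s\<close> is an integer and no seminorm of fractional order enters.\<close>
  have u_reg: "u \<epsilon> \<in> Hsp \<Omega> (l h)" if "\<epsilon> > 0" for \<epsilon> h
  proof (cases "real (r h) + 1 \<le> s")
    case True
    then have "u \<epsilon> \<in> Hsp \<Omega> (real (r h + 1))"
      using s(2) that by (intro Hsp_nat_mono[of _ _ s]) auto
    then show ?thesis using True by (simp add: l_def ell_def min_def add.commute)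
  next
    case False
    then show ?thesis using s(2) that by (simp add: l_def ell_def min_def)
  qed
  have u_H2: "u \<epsilon> \<in> Hsp \<Omega> 2" if "\<epsilon> > 0" for \<epsilon>
    using Hsp_nat_mono[of "u \<epsilon>" \<Omega> s 2] s that by simp
  obtain C where C: "C > 0" "\<And>h v. h \<in> H \<Longrightarrow> v \<in> Hsp \<Omega> (l h) \<Longrightarrow>
      Hnorm \<Omega> 2 (\<lambda>x. v x - Ih h v x) \<le> C * h powr (l h - 2) * Hnorm \<Omega> (l h) v"
  proof -
    have "\<exists>C>0. \<forall>h\<in>H. \<forall>j\<in>{0, 1, 2::nat}. \<forall>v \<in> Hsp \<Omega> (ell r s h).
        Hnorm \<Omega> (real j) (\<lambda>x. v x - Ih h v x)
          \<le> C * h powr (ell r s h - real j) * Hnorm \<Omega> (ell r s h) v"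
      using interp(1) unfolding interpolation_operator_def by (elim conjE)
    then obtain C where "C > 0" and C: "\<forall>h\<in>H. \<forall>j\<in>{0, 1, 2::nat}. \<forall>v \<in> Hsp \<Omega> (ell r s h).
        Hnorm \<Omega> (real j) (\<lambda>x. v x - Ih h v x)
          \<le> C * h powr (ell r s h - real j) * Hnorm \<Omega> (ell r s h) v"
      by (elim exE conjE)
    show ?thesis
    proof (rule that[OF \<open>C > 0\<close>])
      fix h v assume "h \<in> H" "v \<in> Hsp \<Omega> (l h)"
      then show "Hnorm \<Omega> 2 (\<lambda>x. v x - Ih h v x) \<le> C * h powr (l h - 2) * Hnorm \<Omega> (l h) v"
        using C[rule_format, of h 2 v] by (simp add: l_def)
    qed
  qed
  obtain L \<eta> where L: "L \<ge> 3" "\<eta> > 0" "\<forall>h\<in>H. h \<le> \<eta> \<longrightarrow> l h = L"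
    using ell_eventually_constant[OF spaces s(1)] unfolding l_def by (elim exE conjE)
  define C8 where "C8 = (\<lambda>\<epsilon>. C + 2 * C7 \<epsilon>)"
  have "C8 \<in> O[at_right 0](\<lambda>\<epsilon>. 1 / \<epsilon> ^ CARD('n))"
    unfolding C8_def
  proof (rule sum_in_bigo(1))
    have "\<forall>\<^sub>F \<epsilon> in at_right (0::real). norm C \<le> C * norm (1 / \<epsilon> ^ CARD('n))"
    proof (rule eventually_at_rightI[of 0 1])
      fix \<epsilon> :: real assume "\<epsilon> \<in> {0<..<1}"
      then have "0 < \<epsilon> ^ CARD('n)" "\<epsilon> ^ CARD('n) \<le> 1" by (auto intro: power_le_one)
      then show "norm C \<le> C * norm (1 / \<epsilon> ^ CARD('n))" using C(1) by (simp add: field_simps)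
    qed simp
    then show "(\<lambda>\<epsilon>. C) \<in> O[at_right 0](\<lambda>\<epsilon>. 1 / \<epsilon> ^ CARD('n))" by (rule bigoI)
    show "(\<lambda>\<epsilon>. 2 * C7 \<epsilon>) \<in> O[at_right 0](\<lambda>\<epsilon>. 1 / \<epsilon> ^ CARD('n))" using C7(2) by simp
  qed
  moreover have "\<exists>h1>0. \<forall>h\<in>H. h \<le> min (h0 \<epsilon>) h1 \<longrightarrow>
       (\<exists>!uh. uh \<in> B \<epsilon> h (\<rho>1 \<epsilon> h) \<and> galerkin_solution \<Omega> (Vh h) f g \<epsilon> uh) \<and>
       (\<forall>uh. uh \<in> B \<epsilon> h (\<rho>1 \<epsilon> h) \<and> galerkin_solution \<Omega> (Vh h) f g \<epsilon> uh \<longrightarrow>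
          Hnorm \<Omega> 2 (\<lambda>x. u \<epsilon> x - uh x) \<le> C8 \<epsilon> * h powr (l h - 2) * Hnorm \<Omega> (l h) (u \<epsilon>))"
    if \<epsilon>: "\<epsilon> > 0" for \<epsilon>
  proof -
    define K where "K = 2 * C7 \<epsilon> * Hnorm \<Omega> L (u \<epsilon>)"
    have K: "K \<ge> 0"
      unfolding K_def using C7_pos[OF \<epsilon>] by (intro mult_nonneg_nonneg Hnorm_nonneg) auto
    have \<rho>0: "\<rho>0 \<epsilon> > 0" using h0 \<epsilon> by blast
    \<comment> \<open>As \<open>h \<le> 1\<close> and \<open>L - 2 \<ge> 1\<close>, the radius is at most \<open>K h\<close>; the last term of the minimum turns this into \<open>\<rho>1 \<le> \<rho>0\<close>.\<close>
    define h1 where "h1 = min (min 1 \<eta>) (\<rho>0 \<epsilon> / (K + 1))"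
    have "h1 > 0" using L(2) K \<rho>0 by (simp add: h1_def)
    moreover have "(\<exists>!uh. uh \<in> B \<epsilon> h (\<rho>1 \<epsilon> h) \<and> galerkin_solution \<Omega> (Vh h) f g \<epsilon> uh) \<and>
       (\<forall>uh. uh \<in> B \<epsilon> h (\<rho>1 \<epsilon> h) \<and> galerkin_solution \<Omega> (Vh h) f g \<epsilon> uh \<longrightarrow>
          Hnorm \<Omega> 2 (\<lambda>x. u \<epsilon> x - uh x) \<le> C8 \<epsilon> * h powr (l h - 2) * Hnorm \<Omega> (l h) (u \<epsilon>))"
      if h: "h \<in> H" "h \<le> min (h0 \<epsilon>) h1" for h
    proof
      have h_pos: "h > 0" and Vh: "Vh h \<subseteq> Hsp \<Omega> 2"
        using discrete_spaces_finite_dimensional[OF spaces h(1)] by simp_all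
      obtain n :: nat and e where span: "Vh h = span_of {0..<n} e"
        using discrete_spaces_finite_dimensional(3)[OF spaces h(1)] by (elim exE)
      have small: "h \<le> 1" "h \<le> \<eta>" "h \<le> \<rho>0 \<epsilon> / (K + 1)" "h \<le> h0 \<epsilon>"
        using h(2) by (simp_all add: h1_def)
      have lh: "l h = L" using L(3) h(1) small(2) by simp
      let ?c = "Ih h (u \<epsilon>)"
      have c: "?c \<in> Vh_bc \<Omega> (Vh h) g" using interp(2) \<epsilon> h(1) by blast
      have \<rho>1_eq: "\<rho>1 \<epsilon> h = 2 * C7 \<epsilon> * h powr (l h - 2) * Hnorm \<Omega> (l h) (u \<epsilon>)"
        by (simp add: \<rho>1_def l_def)
      have \<rho>1_nonneg: "0 \<le> \<rho>1 \<epsilon> h"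
        unfolding \<rho>1_eq using C7_pos[OF \<epsilon>] by (intro mult_nonneg_nonneg Hnorm_nonneg) auto
      have "h powr (L - 2) \<le> h powr 1"
        using h_pos small(1) L(1) by (intro powr_mono') auto
      then have "K * h powr (L - 2) \<le> K * h"
        using K h_pos by (intro mult_left_mono) auto
      moreover have "K * h \<le> \<rho>0 \<epsilon>"
        using small(3) K h_pos by (simp add: field_simps)
      moreover have "\<rho>1 \<epsilon> h = K * h powr (L - 2)" by (simp add: \<rho>1_eq lh K_def)
      ultimately have \<rho>1_le: "\<rho>1 \<epsilon> h \<le> \<rho>0 \<epsilon>" by linarith
      show "\<exists>!uh. uh \<in> B \<epsilon> h (\<rho>1 \<epsilon> h) \<and> galerkin_solution \<Omega> (Vh h) f g \<epsilon> uh"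
        unfolding B_def
      proof (rule galerkin_solution_unique_in_ball[OF \<Omega> finite_atLeastLessThan span Vh c \<rho>1_nonneg])
        show "\<exists>!z. T_equation \<Omega> (Vh h) f g \<epsilon> (u \<epsilon>) w z" if "w \<in> Vh_bc \<Omega> (Vh h) g" for w
          using T_well_defined \<epsilon> h(1) that by blast
        show "Hnorm \<Omega> 2 (\<lambda>x. ?c x - T_map \<Omega> (Vh h) f g \<epsilon> (u \<epsilon>) ?c x) \<le> \<rho>1 \<epsilon> h / 2"
          using C7(3)[rule_format, OF \<epsilon> h(1)] by (simp add: \<rho>1_eq T_def)
        fix v w
        assume "v \<in> Bh \<Omega> (Vh h) g ?c (\<rho>1 \<epsilon> h)" "w \<in> Bh \<Omega> (Vh h) g ?c (\<rho>1 \<epsilon> h)"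
        then have "v \<in> B \<epsilon> h (\<rho>0 \<epsilon>)" "w \<in> B \<epsilon> h (\<rho>0 \<epsilon>)"
          using \<rho>1_le by (simp_all add: B_def Bh_def)
        then show "Hnorm \<Omega> 2 (\<lambda>x. T_map \<Omega> (Vh h) f g \<epsilon> (u \<epsilon>) v x - T_map \<Omega> (Vh h) f g \<epsilon> (u \<epsilon>) w x)
            \<le> 1 / 2 * Hnorm \<Omega> 2 (\<lambda>x. v x - w x)"
          using h0[rule_format, OF \<epsilon>] h(1) small(4) by (simp add: T_def)
      qed
      show "\<forall>uh. uh \<in> B \<epsilon> h (\<rho>1 \<epsilon> h) \<and> galerkin_solution \<Omega> (Vh h) f g \<epsilon> uh \<longrightarrow>
          Hnorm \<Omega> 2 (\<lambda>x. u \<epsilon> x - uh x) \<le> C8 \<epsilon> * h powr (l h - 2) * Hnorm \<Omega> (l h) (u \<epsilon>)"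
      proof (intro allI impI)
        fix uh assume "uh \<in> B \<epsilon> h (\<rho>1 \<epsilon> h) \<and> galerkin_solution \<Omega> (Vh h) f g \<epsilon> uh"
        then have uh: "uh \<in> Hsp \<Omega> 2" "Hnorm \<Omega> 2 (\<lambda>x. uh x - ?c x) \<le> \<rho>1 \<epsilon> h"
          using Vh by (auto simp: B_def Bh_def Vh_bc_def)
        have c_H2: "?c \<in> Hsp \<Omega> 2" using c Vh by (auto simp: Vh_bc_def)
        have "Hnorm \<Omega> 2 (\<lambda>x. u \<epsilon> x - uh x)
            \<le> Hnorm \<Omega> 2 (\<lambda>x. u \<epsilon> x - ?c x) + Hnorm \<Omega> 2 (\<lambda>x. ?c x - uh x)"
          by (rule H2.triangle[OF u_H2[OF \<epsilon>] c_H2 uh(1)])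
        also have "\<dots> \<le> C * h powr (l h - 2) * Hnorm \<Omega> (l h) (u \<epsilon>) + \<rho>1 \<epsilon> h"
          using C(2)[OF h(1) u_reg[OF \<epsilon>]] H2.diff_commute_le[OF c_H2 uh(1)] uh(2)
          by (intro add_mono) auto
        also have "\<dots> = C8 \<epsilon> * h powr (l h - 2) * Hnorm \<Omega> (l h) (u \<epsilon>)"
          by (simp add: \<rho>1_eq C8_def algebra_simps)
        finally show "Hnorm \<Omega> 2 (\<lambda>x. u \<epsilon> x - uh x)
            \<le> C8 \<epsilon> * h powr (l h - 2) * Hnorm \<Omega> (l h) (u \<epsilon>)" .
      qed
    qed
    ultimately show ?thesis by blast
  qed
  ultimately show ?thesis by blast
qed

end
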